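(* Let $f:\mathbb{R}^m\to\mathbb{R}^n$ be a smooth map whose graph $M=\{(x,f(x)):x\in\mathbb{R}^m\}$ is an (entire) space-like submanifold of $R_n^{m+n}$ with parallel mean curvature. If $$*\Omega = o(r)\quad\text{as } r\to\infty,\qquad r=\sqrt{\sum_{i=1}^m x_i^2},$$ that is, $*\Omega(x)/|x|\to 0$ as $|x|\to\infty$, then $M$ is a space-like $m$-plane.
   Context: $R_n^{m+n}$ denotes $\mathbb{R}^{m+n}$ with the pseudo-Euclidean metric $(\cdot,\cdot)=dx_1^2+\cdots+dx_m^2-dx_{m+1}^2-\cdots-dx_{m+n}^2$. A submanifold is space-like if the metric induced on it by $(\cdot,\cdot)$ is positive definite; for the graph of $f=(f^1,\dots,f^n)$ this means that the matrix $g_{ij}=\delta_{ij}-\sum_{s=1}^n f^s_{x_i}f^s_{x_j}$ is positive definite at every point. For such a graph, define the function $$*\Omega=\Big\{\sqrt{\det\big(\delta_{ij}-\textstyle\sum_{s=1}^n f^s_{x_i}f^s_{x_j}\big)}\Big\}^{-1}.$$ The mean curvature vector is $\vec H=\frac1m\,\mathrm{tr}\,B$, where $B(X,Y)$ is the normal component of $D_XY$ ($D$ the flat connection of $R_n^{m+n}$) and the trace is taken with respect to the induced metric. $M$ has parallel mean curvature if $\nabla^\perp\vec H=0$, where $\nabla^\perp$ is the normal connection. A space-like $m$-plane is an $m$-dimensional affine subspace of $R_n^{m+n}$ on which the induced metric is positive definite. *)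

theory Defs
  imports "HOL-Analysis.Analysis" "HOL-Library.Landau_Symbols"
begin

definition dir_deriv ::
  "'a::real_normed_vector \<Rightarrow> ('a \<Rightarrow> 'b::real_normed_vector) \<Rightarrow> 'a \<Rightarrow> 'b" where
  "dir_deriv v h x = frechet_derivative h (at x) v"

text \<open>
  Total differentiability of every iterated directional derivative; in finite dimension this
  is the same as being of class \<open>C\<^sup>k\<close> for every \<open>k\<close>.
\<close>

definition smooth_map :: "('a::real_normed_vector \<Rightarrow> 'b::real_normed_vector) \<Rightarrow> bool" where
  "smooth_map h \<longleftrightarrow> (\<forall>vs x. foldr dir_deriv vs h differentiable (at x))"

definition pinner :: "('a::real_inner \<times> 'b::real_inner) \<Rightarrow> 'a \<times> 'b \<Rightarrow> real" where
  "pinner p q = fst p \<bullet> fst q - snd p \<bullet> snd q"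

text \<open>
  An immersed submanifold is represented by a global parametrization \<open>F\<close>. Vector fields along
  it are functions of the parameter, and the tangent vector \<open>dF\<^sub>x(u)\<close> is represented by
  \<open>u\<close>. For a field \<open>Y\<close> along \<open>F\<close>, the flat derivative of \<open>Y\<close> in the direction
  \<open>dF\<^sub>x(u)\<close> is then \<open>dir_deriv u Y x\<close>.
\<close>

definition tangent_space ::
  "(real^'m \<Rightarrow> (real^'p) \<times> (real^'q)) \<Rightarrow> real^'m \<Rightarrow> ((real^'p) \<times> (real^'q)) set" where
  "tangent_space F x = range (\<lambda>u. dir_deriv u F x)"

definition normal_space ::
  "(real^'m \<Rightarrow> (real^'p) \<times> (real^'q)) \<Rightarrow> real^'m \<Rightarrow> ((real^'p) \<times> (real^'q)) set" where
  "normal_space F x = {w. \<forall>t\<in>tangent_space F x. pinner w t = 0}"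

definition induced_metric ::
  "(real^'m \<Rightarrow> (real^'p) \<times> (real^'q)) \<Rightarrow> real^'m \<Rightarrow> real^'m \<Rightarrow> real^'m \<Rightarrow> real" where
  "induced_metric F x u v = pinner (dir_deriv u F x) (dir_deriv v F x)"

definition spacelike :: "(real^'m \<Rightarrow> (real^'p) \<times> (real^'q)) \<Rightarrow> bool" where
  "spacelike F \<longleftrightarrow> (\<forall>x u. u \<noteq> 0 \<longrightarrow> induced_metric F x u u > 0)"

text \<open>
  The description below determines a unique vector when \<open>F\<close> is differentiable and space-like;
  see \<open>normal_component_ex1\<close>.
\<close>

definition normal_component ::
  "(real^'m \<Rightarrow> (real^'p) \<times> (real^'q)) \<Rightarrow> real^'m \<Rightarrow> (real^'p) \<times> (real^'q) \<Rightarrow> (real^'p) \<times> (real^'q)" where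
  "normal_component F x w = (THE \<nu>. \<nu> \<in> normal_space F x \<and> w - \<nu> \<in> tangent_space F x)"

text \<open>
  The field extending \<open>dF\<^sub>x(v)\<close> is the one with constant coefficients \<open>v\<close> in the coordinate
  frame; the normal component does not depend on the extension.
\<close>

definition second_fundamental_form ::
  "(real^'m \<Rightarrow> (real^'p) \<times> (real^'q)) \<Rightarrow> real^'m \<Rightarrow> real^'m \<Rightarrow> real^'m \<Rightarrow> (real^'p) \<times> (real^'q)" where
  "second_fundamental_form F x u v = normal_component F x (dir_deriv u (dir_deriv v F) x)"

definition metric_matrix ::
  "(real^'m \<Rightarrow> (real^'p) \<times> (real^'q)) \<Rightarrow> real^'m \<Rightarrow> real^'m^'m" where
  "metric_matrix F x = (\<chi> i j. induced_metric F x (axis i 1) (axis j 1))"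

definition mean_curvature ::
  "(real^'m \<Rightarrow> (real^'p) \<times> (real^'q)) \<Rightarrow> real^'m \<Rightarrow> (real^'p) \<times> (real^'q)" where
  "mean_curvature F x = (1 / real CARD('m)) *\<^sub>R
     (\<Sum>i\<in>UNIV. \<Sum>j\<in>UNIV. matrix_inv (metric_matrix F x) $ i $ j *\<^sub>R
        second_fundamental_form F x (axis i 1) (axis j 1))"

definition normal_connection ::
  "(real^'m \<Rightarrow> (real^'p) \<times> (real^'q)) \<Rightarrow> real^'m \<Rightarrow> (real^'m \<Rightarrow> (real^'p) \<times> (real^'q))
     \<Rightarrow> real^'m \<Rightarrow> (real^'p) \<times> (real^'q)" where
  "normal_connection F u \<xi> x = normal_component F x (dir_deriv u \<xi> x)"

definition parallel_mean_curvature :: "(real^'m \<Rightarrow> (real^'p) \<times> (real^'q)) \<Rightarrow> bool" where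
  "parallel_mean_curvature F \<longleftrightarrow> (\<forall>x u. normal_connection F u (mean_curvature F) x = 0)"

definition graph_param :: "('a \<Rightarrow> 'b) \<Rightarrow> 'a \<Rightarrow> 'a \<times> 'b" where
  "graph_param f x = (x, f x)"

definition star_Omega :: "(real^'m \<Rightarrow> real^'n) \<Rightarrow> real^'m \<Rightarrow> real" where
  "star_Omega f x = inverse (sqrt (det (\<chi> i j. (if i = j then 1 else 0) -
     (\<Sum>s\<in>UNIV. dir_deriv (axis i 1) (\<lambda>y. f y $ s) x *
                  dir_deriv (axis j 1) (\<lambda>y. f y $ s) x) :: real^'m^'m)))"

definition spacelike_plane :: "nat \<Rightarrow> ((real^'p) \<times> (real^'q)) set \<Rightarrow> bool" where
  "spacelike_plane k S \<longleftrightarrow> affine S \<and> aff_dim S = int k \<and>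
     (\<forall>p\<in>S. \<forall>q\<in>S. p \<noteq> q \<longrightarrow> pinner (p - q) (p - q) > 0)"

lemma dir_deriv_graph_param:
  fixes f :: "real^'m \<Rightarrow> real^'n"
  assumes "f differentiable (at x)"
  shows "dir_deriv u (graph_param f) x = (u, dir_deriv u f x)"
proof -
  have "(f has_derivative frechet_derivative f (at x)) (at x)"
    using assms frechet_derivative_works by blast
  then have "(graph_param f has_derivative (\<lambda>u. (u, frechet_derivative f (at x) u))) (at x)"
    unfolding graph_param_def [abs_def] by (intro derivative_intros)
  then show ?thesis
    by (simp add: dir_deriv_def frechet_derivative_at [symmetric])
qed

lemma dir_deriv_component:
  fixes f :: "real^'m \<Rightarrow> real^'n"
  assumes "f differentiable (at x)"
  shows "dir_deriv u (\<lambda>y. f y $ s) x = dir_deriv u f x $ s"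
proof -
  have "(f has_derivative frechet_derivative f (at x)) (at x)"
    using assms frechet_derivative_works by blast
  then have "((\<lambda>y. f y $ s) has_derivative (\<lambda>u. frechet_derivative f (at x) u $ s)) (at x)"
    by (rule bounded_linear.has_derivative [OF bounded_linear_vec_nth])
  then show ?thesis
    by (simp add: dir_deriv_def frechet_derivative_at [symmetric])
qed

lemma star_Omega_eq:
  fixes f :: "real^'m \<Rightarrow> real^'n"
  assumes "f differentiable (at x)"
  shows "star_Omega f x = inverse (sqrt (det (metric_matrix (graph_param f) x)))"
proof -
  have "metric_matrix (graph_param f) x = (\<chi> i j. (if i = j then 1 else 0) -
     (\<Sum>s\<in>UNIV. dir_deriv (axis i 1) (\<lambda>y. f y $ s) x *
                  dir_deriv (axis j 1) (\<lambda>y. f y $ s) x))"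
    by (simp add: metric_matrix_def induced_metric_def pinner_def dir_deriv_graph_param [OF assms]
        dir_deriv_component [OF assms] vec_eq_iff inner_axis_axis inner_vec_def [of "dir_deriv _ _ _"])
  then show ?thesis
    by (simp add: star_Omega_def)
qed

lemma normal_component_ex1:
  fixes F :: "real^'m \<Rightarrow> (real^'p) \<times> (real^'q)"
  assumes "F differentiable (at x)" and "spacelike F"
  shows "\<exists>!\<nu>. \<nu> \<in> normal_space F x \<and> w - \<nu> \<in> tangent_space F x"
proof -
  define L where "L u = dir_deriv u F x" for u
  have lin: "linear L"
    using assms(1) by (simp add: L_def [abs_def] dir_deriv_def linear_frechet_derivative)
  define A where "A v = (\<chi> i. pinner (L v) (L (axis i 1)))" for v
  have expand: "pinner p (L u) = (\<Sum>i\<in>UNIV. u $ i * pinner p (L (axis i 1)))" for p u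
  proof -
    have lp: "linear (\<lambda>u. pinner p (L u))"
      unfolding pinner_def using lin
      by (intro linearI) (auto simp: linear_add linear_scale algebra_simps inner_add_right)
    have "pinner p (L u) = pinner p (L (\<Sum>i\<in>UNIV. u $ i *\<^sub>R axis i 1))"
      by (simp add: basis_expansion flip: scalar_mult_eq_scaleR)
    then show ?thesis
      using linear_sum [OF lp, of "\<lambda>i. u $ i *\<^sub>R axis i 1" UNIV] linear_scale [OF lp] by simp
  qed
  have linA: "linear A"
    unfolding A_def pinner_def using lin
    by (intro linearI) (auto simp: linear_add linear_scale vec_eq_iff algebra_simps inner_add_left)
  have pos: "v = 0" if "pinner (L v) (L v) = 0" for v
    using assms(2) that unfolding spacelike_def induced_metric_def L_def by (metis less_irrefl)
  have "inj A"
    unfolding linear_injective_0 [OF linA]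
  proof (intro allI impI)
    fix v assume "A v = 0"
    then show "v = 0"
      by (intro pos) (simp add: expand [of "L v" v] A_def vec_eq_iff)
  qed
  then have "surj A"
    using linA linear_injective_imp_surjective by blast
  then obtain v where v: "A v = (\<chi> i. pinner w (L (axis i 1)))"
    by (metis surjD)
  have norm_iff: "\<nu> \<in> normal_space F x \<longleftrightarrow> (\<forall>u. pinner \<nu> (L u) = 0)" for \<nu>
    by (auto simp: normal_space_def tangent_space_def L_def)
  have diff: "pinner (a - b) c = pinner a c - pinner b c" for a b c :: "(real^'p) \<times> (real^'q)"
    by (simp add: pinner_def inner_diff_left)
  show ?thesis
  proof (rule ex1I [where a = "w - L v"])
    have "pinner (w - L v) (L (axis i 1)) = 0" for i
      using v by (simp add: A_def vec_eq_iff diff)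
    then have "pinner (w - L v) (L u) = 0" for u
      by (simp add: expand [of "w - L v" u])
    then show "w - L v \<in> normal_space F x \<and> w - (w - L v) \<in> tangent_space F x"
      unfolding norm_iff by (simp add: tangent_space_def L_def)
  next
    fix \<nu> assume n: "\<nu> \<in> normal_space F x \<and> w - \<nu> \<in> tangent_space F x"
    then obtain t where t: "w - \<nu> = L t" by (auto simp: tangent_space_def L_def)
    have "A t = A v"
      unfolding v using n norm_iff by (simp add: A_def t [symmetric] diff)
    then have "t = v" using \<open>inj A\<close> by (simp add: inj_eq)
    then show "\<nu> = w - L v" using t by (metis diff_diff_eq2 add_diff_cancel_left')
  qed
qed

end

theory Submission
  imports Defs
begin

text \<open>
  Write \<open>P\<close> for the differential of \<open>f\<close> and \<open>b\<close> for its second derivative. The induced metric is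
  \<open>g = I - P\<^sup>T P\<close>; its eigenvalues lie in \<open>(0,1]\<close>, so \<open>G = g\<^sup>-\<^sup>1\<close> is at most
  \<open>1 / det g\<close>, the square of \<open>*\<Omega>\<close>. Projecting \<open>(0,a)\<close> to the normal space gives
  \<open>(Y a, K a)\<close> with \<open>Y = G P\<^sup>T\<close> and \<open>K = I + P Y\<close>. This trivializes the normal bundle, and in the
  trivialization the second fundamental form is simply \<open>b\<close>, with \<open>K\<close> as (positive) inner product.
  The growth hypothesis enters twice, and each time \<open>o(r)\<close> is exactly what is needed.

  \<^emph>\<open>The mean curvature vanishes.\<close> Let \<open>\<tau>\<close> be the \<open>g\<close>-trace of \<open>b\<close>, so that the mean curvature
  vector is \<open>(Y \<tau>, K \<tau>) / m\<close>. If it is parallel, then its derivative is tangential, hence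
  given by its shape operator; the trace of the latter says that the vector field
  \<open>Y \<tau>\<close> on \<open>\<real>\<^sup>m\<close> has Euclidean divergence \<open>\<tau> \<bullet> K \<tau>\<close>, and this number is constant (lemmas
  \<open>parallel_tau\<close>, \<open>divergence_Y_tau\<close>, \<open>sq_tau_constant\<close>). But \<open>Y \<tau>\<close> is bounded by a multiple of
  \<open>*\<Omega>\<close>, so its flux through large spheres is of lower order than the volume of the balls
  (\<open>constant_divergence_le\<close>). Hence \<open>\<tau> = 0\<close>.

  \<^emph>\<open>The second fundamental form vanishes.\<close> For a maximal graph the linear coordinates are
  harmonic, so the Laplacian of the graph is \<open>\<Sum>\<^sub>p \<partial>\<^sub>p\<partial>\<^sub>p\<close> along a constant frame that is
  \<open>g\<close>-orthonormal at the point considered. The Codazzi and Ricci equations give the Simons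
  inequality: the Laplacian of \<open>|b|\<^sup>2\<close> is at least \<open>(2/n) |b|\<^sup>4\<close> (\<open>laplacian_sq_sff_ge\<close>). Since the
  Laplacian and the squared gradient of \<open>|x - c|\<^sup>2\<close> are controlled by the trace of \<open>G\<close>, the maximum
  principle applied to \<open>|b|\<^sup>2 (R\<^sup>2 - |x - c|\<^sup>2)\<^sup>2\<close> bounds \<open>|b|\<^sup>2(c)\<close> by a constant times
  \<open>sup (*\<Omega>)\<^sup>2 / R\<^sup>2\<close> over the ball of radius \<open>R\<close> (\<open>interior_estimate_sq_sff\<close>). As \<open>R\<close> grows
  this tends to zero. So \<open>b = 0\<close>, \<open>f\<close> is affine, and the graph is a space-like plane.
\<close>

section \<open>Orthonormal eigenbases of self-adjoint operators\<close>

text \<open>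
  A maximum point of the Rayleigh quotient on the unit sphere of \<open>V\<close> is critical, so \<open>A u\<close> is
  orthogonal to every vector of \<open>V\<close> that is orthogonal to \<open>u\<close>; invariance of \<open>V\<close> then forces
  \<open>A u\<close> to be a multiple of \<open>u\<close>.
\<close>

lemma eigenvector_in_subspace:
  fixes A :: "'a::euclidean_space \<Rightarrow> 'a"
  assumes lin: "linear A" and sym: "\<And>x y. A x \<bullet> y = x \<bullet> A y"
    and V: "subspace V" "A ` V \<subseteq> V" "V \<noteq> {0}"
  obtains u l where "u \<in> V" "norm u = 1" "A u = l *\<^sub>R u"
proof -
  interpret A: linear A by (rule lin)
  obtain v where v: "v \<in> V" "v \<noteq> 0"
    using V(1,3) subspace_0 by blast
  define C where "C = sphere 0 1 \<inter> V"
  have "compact C"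
    unfolding C_def by (intro compact_Int_closed compact_sphere closed_subspace V)
  moreover have "v /\<^sub>R norm v \<in> C"
    using v V(1) by (simp add: C_def subspace_scale)
  moreover have "continuous_on C (\<lambda>x. x \<bullet> A x)"
    by (intro continuous_intros linear_continuous_on linear_linear[THEN iffD2] lin)
  ultimately obtain u where u: "u \<in> C" and umax: "\<And>x. x \<in> C \<Longrightarrow> x \<bullet> A x \<le> u \<bullet> A u"
    using continuous_attains_sup[of C "\<lambda>x. x \<bullet> A x"] by blast
  define l where "l = u \<bullet> A u"
  have uV: "u \<in> V" and u1: "norm u = 1" using u by (auto simp: C_def)
  have le: "x \<bullet> A x \<le> l * (x \<bullet> x)" if "x \<in> V" for x
  proof (cases "x = 0")
    case False
    then have "x /\<^sub>R norm x \<in> C"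
      using that V(1) by (simp add: C_def subspace_scale)
    from umax[OF this] have "(x \<bullet> A x) / (norm x * norm x) \<le> l"
      by (simp add: l_def A.scaleR divide_simps)
    then show ?thesis using False
      by (simp add: divide_simps norm_eq_sqrt_inner split: if_splits)
  qed (simp add: A.zero)
  have orth: "w \<bullet> A u = 0" if w: "w \<in> V" "w \<bullet> u = 0" for w
  proof -
    have ineq: "2 * t * (w \<bullet> A u) + t^2 * (w \<bullet> A w - l * (w \<bullet> w)) \<le> 0" for t
    proof -
      have "u + t *\<^sub>R w \<in> V"
        using uV w V(1) by (simp add: subspace_add subspace_scale)
      from le[OF this] show ?thesis
        using u1 w(2) sym[of u w]
        by (simp add: A.add A.scaleR inner_add_left inner_add_right l_def algebra_simps
            inner_commute power2_eq_square norm_eq_1)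
    qed
    \<comment> \<open>A quadratic polynomial without constant term that is nowhere positive has no linear term;
        the parameter \<open>a / c\<close> is small enough for the linear term to dominate.\<close>
    show ?thesis
    proof (rule ccontr)
      assume nz: "w \<bullet> A u \<noteq> 0"
      define a where "a = w \<bullet> A u"
      define c where "c = \<bar>w \<bullet> A w - l * (w \<bullet> w)\<bar> + 1"
      have "2 * (a / c) * a + (a/c)^2 * (w \<bullet> A w - l * (w \<bullet> w)) \<le> 0"
        using ineq[of "a / c"] by (simp add: a_def)
      moreover have "(a/c)^2 * (w \<bullet> A w - l * (w \<bullet> w)) \<ge> - ((a/c)^2 * c)"
      proof -
        have "w \<bullet> A w - l * (w \<bullet> w) \<ge> - c" by (simp add: c_def)
        then have "(a/c)^2 * (w \<bullet> A w - l * (w \<bullet> w)) \<ge> (a/c)^2 * (- c)"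
          by (intro mult_left_mono) auto
        then show ?thesis by simp
      qed
      moreover have c: "c > 0" by (simp add: c_def)
      moreover have "(a/c)^2 * c = a^2 / c" "2 * (a / c) * a = 2 * (a^2 / c)"
        using c by (simp_all add: power2_eq_square)
      ultimately have "a^2 / c \<le> 0" by linarith
      then show False using nz \<open>c > 0\<close>
        by (simp add: a_def divide_le_0_iff)
    qed
  qed
  have "A u - l *\<^sub>R u \<in> V"
    using V uV by (simp add: subspace_diff subspace_scale image_subset_iff)
  moreover have "(A u - l *\<^sub>R u) \<bullet> u = 0"
    using u1 sym[of u u] by (simp add: inner_diff_left l_def norm_eq_1)
  ultimately have "(A u - l *\<^sub>R u) \<bullet> A u = 0" "(A u - l *\<^sub>R u) \<bullet> u = 0"
    by (auto intro: orth)
  then have "(A u - l *\<^sub>R u) \<bullet> (A u - l *\<^sub>R u) = 0"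
    by (metis diff_zero inner_diff_right inner_scaleR_right mult_zero_right)
  then have "A u = l *\<^sub>R u" by simp
  then show ?thesis using that uV u1 by blast
qed

text \<open>
  Induction on the dimension: the part of \<open>V\<close> orthogonal to an eigenvector is again invariant,
  because \<open>A\<close> is self-adjoint.
\<close>

lemma orthonormal_eigenvectors_span:
  fixes A :: "'a::euclidean_space \<Rightarrow> 'a"
  assumes lin: "linear A" and sym: "\<And>x y. A x \<bullet> y = x \<bullet> A y"
    and "subspace V" "A ` V \<subseteq> V"
  shows "\<exists>B \<subseteq> V. pairwise orthogonal B \<and> (\<forall>b\<in>B. norm b = 1 \<and> (\<exists>l. A b = l *\<^sub>R b)) \<and> span B = V"
  using assms(3,4)
proof (induction "dim V" arbitrary: V rule: less_induct)
  case (less V)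
  interpret A: linear A by (rule lin)
  show ?case
  proof (cases "V = {0}")
    case True
    then show ?thesis by (intro exI[of _ "{}"]) (auto simp: pairwise_def)
  next
    case False
    obtain u l where u: "u \<in> V" "norm u = 1" "A u = l *\<^sub>R u"
      using eigenvector_in_subspace[OF lin sym less.prems False] by blast
    define W where "W = V \<inter> {v. u \<bullet> v = 0}"
    have W: "subspace W"
      unfolding W_def by (intro subspace_inter less.prems subspace_hyperplane)
    have AW: "A ` W \<subseteq> W"
    proof -
      have "u \<bullet> A v = 0" if "u \<bullet> v = 0" for v
        using sym[of u v] u(3) that by simp
      then show ?thesis using less.prems(2) by (auto simp: W_def)
    qed
    have "u \<notin> W" using u(2) by (auto simp: W_def)
    have "W \<subset> V" using u(1) \<open>u \<notin> W\<close> unfolding W_def by blast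
    then have "dim W < dim V"
      using dim_psubset[of W V] W less.prems(1) by (metis span_eq_iff)
    from less.hyps[OF this W AW] obtain B where B: "B \<subseteq> W" "pairwise orthogonal B"
      "\<forall>b\<in>B. norm b = 1 \<and> (\<exists>l. A b = l *\<^sub>R b)" "span B = W" by blast
    have "span (insert u B) = V"
    proof
      show "span (insert u B) \<subseteq> V"
        using u(1) B(1) less.prems(1) by (intro span_minimal) (auto simp: W_def)
      show "V \<subseteq> span (insert u B)"
      proof
        fix v assume "v \<in> V"
        then have "v - (u \<bullet> v) *\<^sub>R u \<in> W"
          using u(1,2) less.prems(1)
          by (simp add: W_def subspace_diff subspace_scale inner_diff_right norm_eq_1)
        then have "v - (u \<bullet> v) *\<^sub>R u \<in> span (insert u B)"
          using B(4) span_mono[of B "insert u B"] by blast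
        then have "(v - (u \<bullet> v) *\<^sub>R u) + (u \<bullet> v) *\<^sub>R u \<in> span (insert u B)"
          by (intro span_add span_scale) (auto intro: span_base)
        then show "v \<in> span (insert u B)" by simp
      qed
    qed
    moreover have "pairwise orthogonal (insert u B)"
      using B(1,2) by (auto simp: pairwise_insert W_def orthogonal_def inner_commute)
    ultimately show ?thesis
      using u B(1,3) by (intro exI[of _ "insert u B"]) (auto simp: W_def)
  qed
qed

text \<open>
  An orthonormal basis indexed by the coordinates, so that a determinant becomes a product over
  the same index type.
\<close>

definition orthonormal_frame :: "('k \<Rightarrow> real^'k) \<Rightarrow> bool" where
  "orthonormal_frame e \<longleftrightarrow> (\<forall>p q. e p \<bullet> e q = (if p = q then 1 else 0)) \<and>
     (\<forall>v. (\<Sum>p\<in>UNIV. (v \<bullet> e p) *\<^sub>R e p) = v)"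

lemma orthonormal_frame_inner: "orthonormal_frame e \<Longrightarrow> e p \<bullet> e q = (if p = q then 1 else 0)"
  by (simp add: orthonormal_frame_def)

lemma orthonormal_frame_expand: "orthonormal_frame e \<Longrightarrow> (\<Sum>p\<in>UNIV. (v \<bullet> e p) *\<^sub>R e p) = v"
  by (simp add: orthonormal_frame_def)

lemma self_adjoint_orthonormal_eigenbasis:
  fixes A :: "real^'k \<Rightarrow> real^'k"
  assumes lin: "linear A" and sym: "\<And>x y. A x \<bullet> y = x \<bullet> A y"
  obtains e :: "'k \<Rightarrow> real^'k" and l :: "'k \<Rightarrow> real"
  where "orthonormal_frame e" "\<forall>p. A (e p) = l p *\<^sub>R e p"
proof -
  obtain B where B: "pairwise orthogonal B"
      "\<forall>b\<in>B. norm b = 1 \<and> (\<exists>l. A b = l *\<^sub>R b)" "span B = UNIV"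
    using orthonormal_eigenvectors_span[OF lin sym subspace_UNIV] by auto
  have "0 \<notin> B" using B(2) by fastforce
  then have ind: "independent B" using B(1) pairwise_orthogonal_independent by blast
  then have fin: "finite B" using independent_imp_finite by blast
  have "card B = dim (UNIV :: (real^'k) set)"
    using ind B(3) dim_span_eq_card_independent by metis
  then have "card B = card (UNIV :: 'k set)" by simp
  then obtain e :: "'k \<Rightarrow> real^'k" where e: "bij_betw e UNIV B"
    using fin finite_same_card_bij[of "UNIV :: 'k set" B] by auto
  then have eB: "e p \<in> B" for p by (auto simp: bij_betw_def)
  have on: "e p \<bullet> e q = (if p = q then 1 else 0)" for p q
  proof (cases "p = q")
    case True
    then show ?thesis using eB[of p] B(2) by (simp add: norm_eq_1)
  next
    case False
    then have "e p \<noteq> e q" using e by (auto simp: bij_betw_def inj_on_def)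
    then have "orthogonal (e p) (e q)" by (rule pairwiseD[OF B(1) eB eB])
    then show ?thesis using False by (simp add: orthogonal_def)
  qed
  have "\<forall>p. \<exists>l. A (e p) = l *\<^sub>R e p" using eB B(2) by blast
  then obtain l where l: "\<And>p. A (e p) = l p *\<^sub>R e p" by metis
  have "(\<Sum>p\<in>UNIV. (v \<bullet> e p) *\<^sub>R e p) = v" for v
  proof -
    define w where "w = (\<Sum>p\<in>UNIV. (v \<bullet> e p) *\<^sub>R e p)"
    have we: "w \<bullet> e q = v \<bullet> e q" for q
      by (simp add: w_def inner_sum_left on mult_delta_right)
    have "(v - w) \<bullet> b = 0" if "b \<in> B" for b
    proof -
      obtain q where "b = e q" using \<open>b \<in> B\<close> e unfolding bij_betw_def by blast
      then show ?thesis by (simp add: inner_diff_left we)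
    qed
    then have "orthogonal (v - w) x" if "x \<in> span B" for x
      using orthogonal_to_span[OF that, of "v - w"] by (simp add: orthogonal_def inner_commute)
    then have "orthogonal (v - w) (v - w)" using B(3) by blast
    then show ?thesis by (simp add: orthogonal_def w_def)
  qed
  then have "orthonormal_frame e" using on by (simp add: orthonormal_frame_def)
  then show ?thesis using that l by blast
qed

lemma det_eq_prod_eigenvalues:
  fixes A :: "real^'k^'k" and e :: "'k \<Rightarrow> real^'k"
  assumes on: "orthonormal_frame e"
    and eig: "\<And>p. A *v e p = l p *\<^sub>R e p"
  shows "det A = prod l UNIV"
proof -
  define U :: "real^'k^'k" where "U = (\<chi> i j. e j $ i)"
  define D :: "real^'k^'k" where "D = (\<chi> i j. if i = j then l j else 0)"
  have "transpose U ** U = mat 1"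
    using orthonormal_frame_inner[OF on] by (simp add: vec_eq_iff matrix_matrix_mult_def transpose_def U_def mat_def inner_vec_def)
  then have "det U * det U = 1"
    by (metis det_I det_mul det_transpose)
  moreover have "A ** U = U ** D"
  proof -
    have "(A ** U) $ i $ j = (A *v e j) $ i" for i j
      by (simp add: matrix_matrix_mult_def matrix_vector_mult_def U_def)
    moreover have "(U ** D) $ i $ j = (l j *\<^sub>R e j) $ i" for i j
      by (simp add: matrix_matrix_mult_def U_def D_def mult_delta_right mult.commute)
    ultimately show ?thesis by (simp add: eig vec_eq_iff)
  qed
  then have "det A * det U = det U * det D" by (metis det_mul)
  moreover have "det D = prod l UNIV"
    by (subst det_diagonal) (auto simp: D_def)
  ultimately show ?thesis
    by (metis mult.commute mult_cancel_left mult_zero_left zero_neq_one)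
qed

section \<open>Second derivatives of smooth maps\<close>

text \<open>
  The second difference of \<open>h\<close> is symmetric in \<open>u\<close> and \<open>v\<close>. The mean value theorem along \<open>u\<close>
  expresses it through the values of \<open>dir_deriv u h\<close> at two points near \<open>x\<close>, and differentiability
  of that function at \<open>x\<close> identifies the limit. Exchanging the roles of \<open>u\<close> and \<open>v\<close>
  gives the symmetry of second derivatives.
\<close>

lemma mixed_difference_quotient_tendsto:
  fixes h :: "'a::real_normed_vector \<Rightarrow> real"
  assumes h: "\<And>y. h differentiable (at y)"
    and hu: "dir_deriv u h differentiable (at x)"
  shows "((\<lambda>t. (h (x + t *\<^sub>R u + t *\<^sub>R v) - h (x + t *\<^sub>R u) - h (x + t *\<^sub>R v) + h x) / t^2)
     \<longlongrightarrow> dir_deriv v (dir_deriv u h) x) (at_right 0)"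
proof -
  define k where "k = dir_deriv u h"
  define D where "D = frechet_derivative k (at x)"
  have D: "(k has_derivative D) (at x)"
    using hu frechet_derivative_works by (auto simp: k_def D_def)
  then interpret D: bounded_linear D by (rule has_derivative_bounded_linear)
  have line: "((\<lambda>s. h (y + s *\<^sub>R u)) has_real_derivative k (y + s *\<^sub>R u)) (at s)" for y s
  proof -
    have 1: "(h has_derivative frechet_derivative h (at (y + s *\<^sub>R u))) (at (y + s *\<^sub>R u))"
      using h frechet_derivative_works by blast
    have "((\<lambda>s. h (y + s *\<^sub>R u)) has_derivative (\<lambda>r. frechet_derivative h (at (y + s *\<^sub>R u)) (r *\<^sub>R u))) (at s)"
      by (rule has_derivative_compose[of "\<lambda>s. y + s *\<^sub>R u" "\<lambda>r. r *\<^sub>R u" s UNIV h, OF _ 1])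
        (auto intro!: derivative_eq_intros)
    then show ?thesis
      unfolding has_field_derivative_def k_def dir_deriv_def
      using linear_scale[OF linear_frechet_derivative[OF h]]
      by (auto elim!: has_derivative_eq_rhs simp: mult.commute)
  qed
  show ?thesis unfolding k_def[symmetric]
  proof (rule tendstoI)
    fix e :: real assume e: "e > 0"
    define M where "M = 2 * norm u + norm v + 1 + (norm u + norm v)"
    have M: "M > 0" by (simp add: M_def add_pos_nonneg add_nonneg_pos)
    obtain d where d: "d > 0"
      and dd: "\<And>y. norm (y - x) < d \<Longrightarrow> norm (k y - k x - D (y - x)) \<le> e / (2 * M) * norm (y - x)"
      using D e M unfolding has_derivative_at_alt by (metis divide_pos_pos mult_pos_pos zero_less_numeral)
    have "dist ((h (x + t *\<^sub>R u + t *\<^sub>R v) - h (x + t *\<^sub>R u) - h (x + t *\<^sub>R v) + h x) / t^2) (D v) < e"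
      if t: "0 < t" "t < d / M" for t
    proof -
      define \<phi> where "\<phi> s = h ((x + t *\<^sub>R v) + s *\<^sub>R u) - h (x + s *\<^sub>R u)" for s
      have der: "(\<phi> has_real_derivative (k ((x + t *\<^sub>R v) + s *\<^sub>R u) - k (x + s *\<^sub>R u))) (at s)" for s
        unfolding \<phi>_def by (intro derivative_intros line)
      obtain z where z: "0 < z" "z < t"
        and eq: "\<phi> t - \<phi> 0 = (t - 0) * (k ((x + t *\<^sub>R v) + z *\<^sub>R u) - k (x + z *\<^sub>R u))"
        using MVT2[OF t(1) der] by blast
      have small: "norm (z *\<^sub>R u) \<le> t * norm u" using z by (simp add: mult_right_mono)
      have n1: "norm (t *\<^sub>R v + z *\<^sub>R u) \<le> t * (norm u + norm v)"
        using norm_triangle_ineq[of "t *\<^sub>R v" "z *\<^sub>R u"] small t by (simp add: algebra_simps)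
      have n2: "norm (z *\<^sub>R u) \<le> t * (norm u + norm v)"
        using small t by (simp add: algebra_simps add_increasing2)
      have tM: "t * (norm u + norm v) < d"
      proof -
        have "t * (norm u + norm v) \<le> t * M" using t by (intro mult_left_mono) (auto simp: M_def)
        also have "\<dots> < d" using t M by (simp add: pos_less_divide_eq)
        finally show ?thesis .
      qed
      let ?a = "k ((x + t *\<^sub>R v) + z *\<^sub>R u)" and ?b = "k (x + z *\<^sub>R u)"
      define q where "q = e / (2 * M) * (t * (norm u + norm v))"
      have nn: "e / (2 * M) \<ge> 0" using e M by simp
      have "norm (?a - k x - D (t *\<^sub>R v + z *\<^sub>R u)) \<le> e / (2 * M) * norm (t *\<^sub>R v + z *\<^sub>R u)"
        using dd[of "(x + t *\<^sub>R v) + z *\<^sub>R u"] n1 tM by (simp add: add.assoc)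
      also have "\<dots> \<le> q"
        unfolding q_def by (rule mult_left_mono[OF n1 nn])
      finally have qa: "\<bar>?a - k x - (t * D v + z * D u)\<bar> \<le> q" by (simp add: D.add D.scaleR)
      have "norm (?b - k x - D (z *\<^sub>R u)) \<le> e / (2 * M) * norm (z *\<^sub>R u)"
        using dd[of "x + z *\<^sub>R u"] n2 tM by simp
      also have "\<dots> \<le> q"
        unfolding q_def by (rule mult_left_mono[OF n2 nn])
      finally have qb: "\<bar>?b - k x - z * D u\<bar> \<le> q" by (simp add: D.scaleR)
      have "norm (?a - ?b - t * D v) \<le> 2 * q"
        using qa qb unfolding real_norm_def by linarith
      also have "\<dots> = t * (e * ((norm u + norm v) / M))" by (simp add: q_def)
      also have "\<dots> < t * (e * 1)"
      proof -
        have "norm u + norm v < M"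
          unfolding M_def using norm_ge_zero[of u] norm_ge_zero[of v] by linarith
        then have "(norm u + norm v) / M < 1" using M by simp
        then show ?thesis using t e by (intro mult_strict_left_mono) auto
      qed
      finally have fin: "\<bar>?a - ?b - t * D v\<bar> < t * e" by simp
      have num: "h (x + t *\<^sub>R u + t *\<^sub>R v) - h (x + t *\<^sub>R u) - h (x + t *\<^sub>R v) + h x = t * (?a - ?b)"
      proof -
        have "h (x + t *\<^sub>R u + t *\<^sub>R v) = h (x + t *\<^sub>R v + t *\<^sub>R u)" by (simp add: ac_simps)
        then show ?thesis using eq by (simp add: \<phi>_def)
      qed
      have "(t * (?a - ?b)) / t^2 - D v = (?a - ?b - t * D v) / t"
        using t by (simp add: field_simps power2_eq_square)
      then have "\<bar>(t * (?a - ?b)) / t^2 - D v\<bar> = \<bar>?a - ?b - t * D v\<bar> / t"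
        using t by simp
      also have "\<dots> < e"
        using fin t by (simp only: pos_divide_less_eq mult.commute)
      finally show ?thesis unfolding num dist_real_def .
    qed
    then show "\<forall>\<^sub>F t in at_right 0. dist ((h (x + t *\<^sub>R u + t *\<^sub>R v) - h (x + t *\<^sub>R u) - h (x + t *\<^sub>R v) + h x) / t^2) (dir_deriv v k x) < e"
      unfolding eventually_at_right_field dir_deriv_def D_def[symmetric] using d M
      by (intro exI[of _ "d / M"]) auto
  qed
qed

lemma dir_deriv_commute_real:
  fixes h :: "'a::real_normed_vector \<Rightarrow> real"
  assumes h: "\<And>y. h differentiable (at y)"
    and "dir_deriv u h differentiable (at x)" "dir_deriv v h differentiable (at x)"
  shows "dir_deriv u (dir_deriv v h) x = dir_deriv v (dir_deriv u h) x"
proof -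
  have 1: "((\<lambda>t. (h (x + t *\<^sub>R u + t *\<^sub>R v) - h (x + t *\<^sub>R u) - h (x + t *\<^sub>R v) + h x) / t^2)
     \<longlongrightarrow> dir_deriv v (dir_deriv u h) x) (at_right 0)"
    by (rule mixed_difference_quotient_tendsto[OF h assms(2)])
  have "((\<lambda>t. (h (x + t *\<^sub>R u + t *\<^sub>R v) - h (x + t *\<^sub>R u) - h (x + t *\<^sub>R v) + h x) / t^2)
     \<longlongrightarrow> dir_deriv u (dir_deriv v h) x) (at_right 0)"
    using mixed_difference_quotient_tendsto[OF h assms(3), of u]
    by (simp add: algebra_simps)
  from tendsto_unique[OF _ this 1] show ?thesis by simp
qed

lemma smooth_map_differentiable: "smooth_map h \<Longrightarrow> h differentiable (at x)"
  using foldr.simps(1) by (auto simp: smooth_map_def dest!: spec[of _ "[]"])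

lemma smooth_map_dir_deriv: "smooth_map h \<Longrightarrow> smooth_map (dir_deriv v h)"
  unfolding smooth_map_def
proof (intro allI)
  fix vs x assume "\<forall>vs x. foldr dir_deriv vs h differentiable (at x)"
  then have "foldr dir_deriv (vs @ [v]) h differentiable (at x)" by blast
  then show "foldr dir_deriv vs (dir_deriv v h) differentiable (at x)" by simp
qed

lemma dir_deriv_has_derivative:
  "h differentiable (at x) \<Longrightarrow> (h has_derivative (\<lambda>u. dir_deriv u h x)) (at x)"
  unfolding dir_deriv_def using frechet_derivative_works by blast

lemma dir_deriv_eqI: "(h has_derivative h') (at x) \<Longrightarrow> dir_deriv u h x = h' u"
  unfolding dir_deriv_def using frechet_derivative_at by metis

lemma dir_deriv_inner:
  fixes h :: "'a::real_normed_vector \<Rightarrow> 'b::real_inner"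
  assumes "h differentiable (at x)"
  shows "dir_deriv u (\<lambda>y. h y \<bullet> i) x = dir_deriv u h x \<bullet> i"
  by (rule dir_deriv_eqI[OF has_derivative_inner_left[OF dir_deriv_has_derivative[OF assms]]])

lemma dir_deriv_commute:
  fixes h :: "'a::real_normed_vector \<Rightarrow> 'b::euclidean_space"
  assumes "smooth_map h"
  shows "dir_deriv u (dir_deriv v h) = dir_deriv v (dir_deriv u h)"
proof
  fix x
  have d: "h differentiable (at y)" "dir_deriv w h differentiable (at y)" for y w
    using assms smooth_map_dir_deriv smooth_map_differentiable by blast+
  have eq: "dir_deriv w (\<lambda>y. h y \<bullet> i) = (\<lambda>y. dir_deriv w h y \<bullet> i)" for w i
    by (rule ext) (rule dir_deriv_inner[OF d(1)])
  show "dir_deriv u (dir_deriv v h) x = dir_deriv v (dir_deriv u h) x"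
  proof (rule euclidean_eqI)
    fix i :: 'b assume "i \<in> Basis"
    have di: "(\<lambda>y. k y \<bullet> i) differentiable (at y)" if "k differentiable (at y)" for k :: "'a \<Rightarrow> 'b" and y
      using that unfolding differentiable_def by (blast intro: has_derivative_inner_left)
    have "dir_deriv u (dir_deriv v (\<lambda>y. h y \<bullet> i)) x = dir_deriv v (dir_deriv u (\<lambda>y. h y \<bullet> i)) x"
      by (rule dir_deriv_commute_real) (auto simp: eq intro!: di d)
    then show "dir_deriv u (dir_deriv v h) x \<bullet> i = dir_deriv v (dir_deriv u h) x \<bullet> i"
      by (simp add: eq dir_deriv_inner d)
  qed
qed

lemma linear_dir_deriv: "h differentiable (at x) \<Longrightarrow> linear (\<lambda>u. dir_deriv u h x)"
  using dir_deriv_has_derivative has_derivative_linear by blast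

section \<open>Differentiating families of linear operators\<close>

text \<open>
  The operators attached to a graph depend on the point and act on vectors that depend on the
  point as well. By this product rule it is enough to differentiate each of them on constant
  vectors.
\<close>

lemma has_derivative_linear_family:
  fixes B :: "'x::real_normed_vector \<Rightarrow> 'a::euclidean_space \<Rightarrow> 'b::real_normed_vector"
  assumes lin: "\<And>y. linear (B y)"
    and dB: "\<And>v. ((\<lambda>y. B y v) has_derivative (\<lambda>h. B' h v)) (at x)"
    and dw: "(w has_derivative w') (at x)"
  shows "((\<lambda>y. B y (w y)) has_derivative (\<lambda>h. B' h (w x) + B x (w' h))) (at x)"
proof -
  have expand: "B y v = (\<Sum>i\<in>Basis. (v \<bullet> i) *\<^sub>R B y i)" for y v
  proof -
    have "B y (\<Sum>i\<in>Basis. (v \<bullet> i) *\<^sub>R i) = (\<Sum>i\<in>Basis. (v \<bullet> i) *\<^sub>R B y i)"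
      unfolding linear_sum[OF lin] linear_scale[OF lin] ..
    then show ?thesis by (simp only: euclidean_representation)
  qed
  have B': "B' h (w x) = (\<Sum>i\<in>Basis. (w x \<bullet> i) *\<^sub>R B' h i)" for h
  proof -
    have "((\<lambda>y. \<Sum>i\<in>Basis. (w x \<bullet> i) *\<^sub>R B y i) has_derivative
        (\<lambda>h. \<Sum>i\<in>Basis. (w x \<bullet> i) *\<^sub>R B' h i)) (at x)"
      by (intro has_derivative_sum has_derivative_scaleR_right dB)
    then have "((\<lambda>y. B y (w x)) has_derivative
        (\<lambda>h. \<Sum>i\<in>Basis. (w x \<bullet> i) *\<^sub>R B' h i)) (at x)"
      by (simp only: expand[symmetric])
    from has_derivative_unique[OF dB this] show ?thesis by (rule fun_cong)
  qed
  have "((\<lambda>y. \<Sum>i\<in>Basis. (w y \<bullet> i) *\<^sub>R B y i) has_derivative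
      (\<lambda>h. \<Sum>i\<in>Basis. (w x \<bullet> i) *\<^sub>R B' h i + (w' h \<bullet> i) *\<^sub>R B x i)) (at x)"
    by (rule has_derivative_sum)
      (rule has_derivative_scaleR[OF has_derivative_inner_left[OF dw] dB])
  then show ?thesis
    by (simp only: sum.distrib expand[symmetric] B'[symmetric])
qed

lemma bilinear_linear: "bilinear M \<Longrightarrow> linear (M u)" "bilinear M \<Longrightarrow> linear (\<lambda>u. M u v)"
  by (auto simp: bilinear_def)

lemma has_derivative_bilinear_family:
  fixes \<Phi> :: "'x::real_normed_vector \<Rightarrow> 'a::euclidean_space \<Rightarrow> 'c::euclidean_space \<Rightarrow> 'b::real_normed_vector"
  assumes \<Phi>: "\<And>y. bilinear (\<Phi> y)"
    and d\<Phi>: "\<And>u v. ((\<lambda>y. \<Phi> y u v) has_derivative (\<lambda>h. \<Phi>' h u v)) (at x)"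
    and w1: "(w1 has_derivative w1') (at x)" and w2: "(w2 has_derivative w2') (at x)"
  shows "((\<lambda>y. \<Phi> y (w1 y) (w2 y)) has_derivative
    (\<lambda>h. \<Phi>' h (w1 x) (w2 x) + \<Phi> x (w1 x) (w2' h) + \<Phi> x (w1' h) (w2 x))) (at x)"
proof -
  have "((\<lambda>y. \<Phi> y u (w2 y)) has_derivative (\<lambda>h. \<Phi>' h u (w2 x) + \<Phi> x u (w2' h))) (at x)" for u
    by (rule has_derivative_linear_family[where B = "\<lambda>y. \<Phi> y u" and B' = "\<lambda>h. \<Phi>' h u",
          OF bilinear_linear(1)[OF \<Phi>] d\<Phi> w2])
  then show ?thesis
    by (rule has_derivative_linear_family[where B = "\<lambda>y u. \<Phi> y u (w2 y)"
        and B' = "\<lambda>h u. \<Phi>' h u (w2 x) + \<Phi> x u (w2' h)", OF bilinear_linear(2)[OF \<Phi>] _ w1])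
qed

lemma differentiable_prod:
  fixes g :: "'i \<Rightarrow> 'a::real_normed_vector \<Rightarrow> real"
  assumes "\<And>i. i \<in> I \<Longrightarrow> g i differentiable (at x)"
  shows "(\<lambda>y. \<Prod>i\<in>I. g i y) differentiable (at x)"
proof -
  from assms have "\<forall>i\<in>I. \<exists>g'. (g i has_derivative g') (at x)"
    by (simp add: differentiable_def)
  then obtain g' where "\<And>i. i \<in> I \<Longrightarrow> (g i has_derivative g' i) (at x)" by metis
  from has_derivative_prod[OF this] show ?thesis by (rule differentiableI)
qed

lemma differentiable_det:
  fixes A :: "'a::real_normed_vector \<Rightarrow> real^'k^'k"
  assumes "\<And>i j. (\<lambda>y. A y $ i $ j) differentiable (at x)"
  shows "(\<lambda>y. det (A y)) differentiable (at x)"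
  unfolding det_def
  by (intro differentiable_sum finite_permutations finite differentiable_mult differentiable_const ballI
      differentiable_prod assms)

lemma differentiable_vec_lambda:
  fixes g :: "'k::finite \<Rightarrow> 'a::real_normed_vector \<Rightarrow> real"
  assumes "\<And>k. g k differentiable (at x)"
  shows "(\<lambda>y. \<chi> k. g k y) differentiable (at x)"
proof -
  have "(\<lambda>y. \<Sum>k\<in>UNIV. g k y *\<^sub>R (axis k 1 :: real^'k)) differentiable (at x)"
    by (intro differentiable_sum differentiable_scaleR differentiable_const assms finite ballI)
  moreover have "(\<chi> k. r k) = (\<Sum>k\<in>UNIV. r k *\<^sub>R (axis k 1 :: real^'k))" for r
    using basis_expansion[of "\<chi> k. r k"] by (simp add: scalar_mult_eq_scaleR)
  ultimately show ?thesis by simp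
qed

lemma linear_expand_Basis:
  assumes "linear L"
  shows "L v = (\<Sum>i\<in>Basis. (v \<bullet> i) *\<^sub>R L i)"
proof -
  have "L (\<Sum>i\<in>Basis. (v \<bullet> i) *\<^sub>R i) = (\<Sum>i\<in>Basis. (v \<bullet> i) *\<^sub>R L i)"
    unfolding linear_sum[OF assms] linear_scale[OF assms] ..
  then show ?thesis by (simp only: euclidean_representation)
qed

text \<open>
  In a contraction an operator may be moved to the other slot as its adjoint. This is what makes
  the covariant derivative compatible with traces.
\<close>

lemma sum_Basis_adjoint:
  fixes M :: "'a::euclidean_space \<Rightarrow> 'a \<Rightarrow> 'b::real_vector"
  assumes M: "bilinear M" and adj: "\<And>u v. A u \<bullet> v = u \<bullet> C v"
  shows "(\<Sum>i\<in>Basis. M (A i) i) = (\<Sum>i\<in>Basis. M i (C i))"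
proof -
  have "(\<Sum>i\<in>Basis. M (A i) i) = (\<Sum>i\<in>Basis. \<Sum>j\<in>Basis. (A i \<bullet> j) *\<^sub>R M j i)"
    by (intro sum.cong refl linear_expand_Basis[OF bilinear_linear(2)[OF M]])
  also have "\<dots> = (\<Sum>j\<in>Basis. \<Sum>i\<in>Basis. (A i \<bullet> j) *\<^sub>R M j i)" by (rule sum.swap)
  also have "\<dots> = (\<Sum>j\<in>Basis. \<Sum>i\<in>Basis. (C j \<bullet> i) *\<^sub>R M j i)"
    by (simp only: adj inner_commute[of "C _"])
  also have "\<dots> = (\<Sum>j\<in>Basis. M j (C j))"
    by (intro sum.cong refl linear_expand_Basis[OF bilinear_linear(1)[OF M], symmetric])
  finally show ?thesis .
qed

lemma bilinear_inner_linear: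
  assumes "linear \<alpha>" "linear \<beta>"
  shows "bilinear (\<lambda>u v. \<alpha> u \<bullet> \<beta> v)"
  unfolding bilinear_def
  by (auto intro!: linearI simp: linear_add[OF assms(1)] linear_scale[OF assms(1)]
      linear_add[OF assms(2)] linear_scale[OF assms(2)] inner_add_left inner_add_right)

lemma sum_Basis_axis: "(\<Sum>i\<in>(Basis :: (real^'k) set). h i) = (\<Sum>j\<in>UNIV. h (axis j 1))"
proof -
  have B: "(Basis :: (real^'k) set) = range (\<lambda>j. axis j 1)" by (auto simp: Basis_vec_def)
  have I: "inj (\<lambda>j. axis j 1 :: real^'k)" by (auto simp: inj_on_def axis_eq_axis)
  show ?thesis unfolding B sum.reindex[OF I] o_def ..
qed

section \<open>Vector fields with constant divergence\<close>

lemma integral_translation_lborel: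
  fixes u :: "'a::euclidean_space \<Rightarrow> real"
  assumes "integrable lborel u"
  shows "(LINT x|lborel. u (c + x)) = (LINT x|lborel. u x)" "integrable lborel (\<lambda>x. u (c + x))"
proof -
  have m: "u \<in> borel_measurable borel" using borel_measurable_integrable[OF assms] by simp
  have "(LINT x|lborel. u x) = (LINT x|distr lborel borel ((+) c). u x)" by (simp only: lborel_distr_plus)
  also have "\<dots> = (LINT x|lborel. u (c + x))" by (rule integral_distr) (use m in auto)
  finally show "(LINT x|lborel. u (c + x)) = (LINT x|lborel. u x)" by simp
  have "integrable (distr lborel borel ((+) c)) u" using assms by (simp only: lborel_distr_plus)
  then show "integrable lborel (\<lambda>x. u (c + x))"
    by (rule integrable_distr[rotated]) simp
qed

lemma integrable_compact_support:
  fixes u :: "'a::euclidean_space \<Rightarrow> real"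
  assumes "continuous_on UNIV u" "\<And>x. x \<notin> cball 0 r \<Longrightarrow> u x = 0"
  shows "integrable lborel u"
proof -
  have "integrable lborel (\<lambda>x. indicator (cball 0 r) x *\<^sub>R u x)"
    by (rule borel_integrable_compact) (auto intro: continuous_on_subset[OF assms(1)])
  moreover have "(\<lambda>x. indicator (cball 0 r) x *\<^sub>R u x) = u"
    using assms(2) by (auto simp: indicator_def fun_eq_iff)
  ultimately show ?thesis by simp
qed

text \<open>
  By translation invariance the difference quotients of \<open>u\<close> have integral zero; they are bounded
  and supported in a fixed ball, so dominated convergence applies.
\<close>

lemma integral_directional_derivative_eq_0:
  fixes u :: "'a::euclidean_space \<Rightarrow> real"
  assumes der: "\<And>x t. ((\<lambda>t. u (x + t *\<^sub>R i)) has_real_derivative u1 (x + t *\<^sub>R i)) (at t)"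
    and cu: "continuous_on UNIV u" and cu1: "continuous_on UNIV u1"
    and su: "\<And>x. x \<notin> cball 0 r \<Longrightarrow> u x = 0" and su1: "\<And>x. x \<notin> cball 0 r \<Longrightarrow> u1 x = 0"
    and i: "norm i = 1"
  shows "(LINT x|lborel. u1 x) = 0"
proof -
  define t where "t k = inverse (real (Suc k))" for k
  have t: "0 < t k" "t k \<le> 1" for k by (auto simp: t_def inverse_le_1_iff)
  define s where "s k x = (u (t k *\<^sub>R i + x) - u x) / t k" for k x
  have iu: "integrable lborel u" by (rule integrable_compact_support[OF cu su])
  have iu1: "integrable lborel u1" by (rule integrable_compact_support[OF cu1 su1])
  have "compact (u1 ` cball 0 r)"
    by (intro compact_continuous_image continuous_on_subset[OF cu1]) auto
  from compact_imp_bounded[OF this] obtain M where "\<forall>y\<in>u1 ` cball 0 r. norm y \<le> M"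
    unfolding bounded_iff by blast
  then have M: "\<bar>u1 x\<bar> \<le> M" if "x \<in> cball 0 r" for x using that by simp
  define M' where "M' = \<bar>M\<bar>"
  have M': "\<bar>u1 x\<bar> \<le> M'" for x
    using M[of x] su1[of x] by (cases "x \<in> cball 0 r") (auto simp: M'_def)
  have bound: "norm (s k x) \<le> M' * indicator (cball 0 (r + 1)) x" for k x
  proof (cases "x \<in> cball 0 (r + 1)")
    case True
    obtain z where "u (x + t k *\<^sub>R i) - u (x + 0 *\<^sub>R i) = (t k - 0) * u1 (x + z *\<^sub>R i)"
      using MVT2[OF t(1) der] by blast
    then have "s k x = u1 (x + z *\<^sub>R i)"
      using t(1)[of k] by (simp add: s_def add.commute)
    then show ?thesis using True M' by simp
  next
    case False
    have "norm x \<le> norm (t k *\<^sub>R i + x) + norm (t k *\<^sub>R i)"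
      using norm_triangle_ineq4[of "t k *\<^sub>R i + x" "t k *\<^sub>R i"] by simp
    moreover have "norm (t k *\<^sub>R i) \<le> 1" using t[of k] i by simp
    ultimately have "t k *\<^sub>R i + x \<notin> cball 0 r" "x \<notin> cball 0 r"
      using False by auto
    then have "s k x = 0" by (simp add: s_def su)
    then show ?thesis using False by simp
  qed
  have "(\<lambda>k. LINT x|lborel. s k x) \<longlonglongrightarrow> (LINT x|lborel. u1 x)"
  proof (rule integral_dominated_convergence[where w = "\<lambda>x. M' * indicator (cball 0 (r + 1)) x"])
    show "u1 \<in> borel_measurable lborel" using iu1 by (rule borel_measurable_integrable)
    show "s k \<in> borel_measurable lborel" for k
      unfolding s_def using borel_measurable_integrable[OF iu] borel_measurable_integrable[OF integral_translation_lborel(2)[OF iu]]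
      by measurable
    have "integrable lborel (indicator (cball (0::'a) (r + 1)) :: 'a \<Rightarrow> real)"
      using emeasure_lborel_cbox_finite emeasure_bounded_finite[OF bounded_cball]
      by (intro integrable_real_indicator) auto
    then show "integrable lborel (\<lambda>x::'a. M' * indicator (cball 0 (r + 1)) x)"
      by (rule integrable_mult_right)
    show "AE x in lborel. (\<lambda>k. s k x) \<longlonglongrightarrow> u1 x"
    proof (rule AE_I2)
      fix x
      have "((\<lambda>t. (u (x + t *\<^sub>R i) - u (x + 0 *\<^sub>R i)) / (t - 0)) \<longlongrightarrow> u1 (x + 0 *\<^sub>R i)) (at 0)"
        using der[of x 0] unfolding has_field_derivative_iff by simp
      moreover have "filterlim t (at 0) sequentially"
      proof (rule filterlim_atI)
        show "t \<longlonglongrightarrow> 0" unfolding t_def by (rule LIMSEQ_inverse_real_of_nat)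
        show "\<forall>\<^sub>F k in sequentially. t k \<noteq> 0" using t(1) by (simp add: less_imp_neq[symmetric])
      qed
      ultimately have "((\<lambda>k. (u (x + t k *\<^sub>R i) - u (x + 0 *\<^sub>R i)) / (t k - 0)) \<longlonglongrightarrow> u1 (x + 0 *\<^sub>R i))"
        by (rule filterlim_compose)
      then show "(\<lambda>k. s k x) \<longlonglongrightarrow> u1 x" by (simp add: s_def add.commute)
    qed
    show "AE x in lborel. norm (s k x) \<le> M' * indicator (cball 0 (r + 1)) x" for k
      using bound by (intro AE_I2)
  qed
  moreover have "(LINT x|lborel. s k x) = 0" for k
  proof -
    have "(LINT x|lborel. s k x) = ((LINT x|lborel. u (t k *\<^sub>R i + x)) - (LINT x|lborel. u x)) / t k"
      unfolding s_def
      using iu integral_translation_lborel(2)[OF iu, of "t k *\<^sub>R i"] by simp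
    then show ?thesis by (simp add: integral_translation_lborel(1)[OF iu])
  qed
  ultimately show ?thesis by (simp add: LIMSEQ_const_iff)
qed

text \<open>
  Squaring the positive part makes it continuously differentiable, which is the regularity needed
  of a cut-off function.
\<close>

lemma has_real_derivative_max_0_squared:
  "((\<lambda>s::real. (max 0 s)\<^sup>2) has_real_derivative 2 * max 0 s) (at s)"
proof (cases "s = 0")
  case True
  have "((\<lambda>h::real. ((max 0 (0 + h))\<^sup>2 - (max 0 0)\<^sup>2) / h) \<longlongrightarrow> 0) (at 0)"
  proof (rule Lim_null_comparison)
    show "\<forall>\<^sub>F h in at (0::real). norm (((max 0 (0 + h))\<^sup>2 - (max 0 0)\<^sup>2) / h) \<le> \<bar>h\<bar>"
      by (rule always_eventually) (auto simp: max_def power2_eq_square)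
    show "((\<lambda>h::real. \<bar>h\<bar>) \<longlongrightarrow> 0) (at 0)"
      by (intro tendsto_rabs_zero tendsto_ident_at)
  qed
  then show ?thesis unfolding True DERIV_def by simp
next
  case False
  show ?thesis
  proof (cases "s > 0")
    case True
    have "((\<lambda>s::real. s\<^sup>2) has_real_derivative 2 * max 0 s) (at s)"
      using True by (auto intro!: derivative_eq_intros)
    then show ?thesis
    proof (rule DERIV_cong_ev[OF refl _ refl, THEN iffD1, rotated])
      show "\<forall>\<^sub>F x in nhds s. x\<^sup>2 = (max 0 x)\<^sup>2"
        using eventually_nhds_in_open[of "{0<..}" s] True by (auto elim!: eventually_mono)
    qed
  next
    case neg: False
    have "((\<lambda>s::real. 0) has_real_derivative 2 * max 0 s) (at s)"
      using neg False by simp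
    then show ?thesis
    proof (rule DERIV_cong_ev[OF refl _ refl, THEN iffD1, rotated])
      show "\<forall>\<^sub>F x in nhds s. 0 = (max 0 x)\<^sup>2"
        using eventually_nhds_in_open[of "{..<0}" s] neg False by (auto elim!: eventually_mono)
    qed
  qed
qed

text \<open>
  Integrate the divergence against the bump function \<open>(max 0 (r\<^sup>2 - |x|\<^sup>2))\<^sup>2\<close>. The mass of the bump is
  at least \<open>r\<^sup>4/2\<close> times the volume of the ball of radius \<open>r/2\<close>. Its gradient is
  \<open>- 4 max 0 (r\<^sup>2 - |x|\<^sup>2) x\<close>, so integration by parts bounds the same integral by
  \<open>4 \<epsilon> r\<^sup>4\<close> times the volume of the ball of radius \<open>r\<close>. The power of 2 is the ratio of the volumes.
\<close>

lemma constant_divergence_le: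
  fixes V :: "'a::euclidean_space \<Rightarrow> 'a" and r \<epsilon> \<kappa> :: real
  assumes dV: "\<And>x. (V has_derivative V' x) (at x)"
    and cV': "\<And>i. i \<in> Basis \<Longrightarrow> continuous_on UNIV (\<lambda>x. V' x i \<bullet> i)"
    and div: "\<And>x. (\<Sum>i\<in>Basis. V' x i \<bullet> i) = \<kappa>"
    and r: "r > 0" and bd: "\<And>x. x \<in> cball 0 r \<Longrightarrow> norm (V x) \<le> \<epsilon> * r" and \<kappa>: "\<kappa> \<ge> 0"
  shows "\<kappa> \<le> 8 * 2 ^ DIM('a) * \<epsilon>"
proof -
  define m where "m x = max 0 (r\<^sup>2 - x \<bullet> x)" for x :: 'a
  have cV: "continuous_on UNIV V"
    by (simp add: continuous_on_eq_continuous_at has_derivative_continuous[OF dV])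
  have cm: "continuous_on UNIV m"
    unfolding m_def by (intro continuous_intros)
  have sm: "m x = 0" if "x \<notin> cball 0 r" for x
  proof -
    have "r\<^sup>2 \<le> (norm x)\<^sup>2" using that r by (intro power_mono) auto
    then show ?thesis by (simp add: m_def power2_norm_eq_inner)
  qed
  have \<epsilon>: "\<epsilon> \<ge> 0"
  proof -
    have "norm (V 0) \<le> \<epsilon> * r" using bd[of 0] r by simp
    then have "0 \<le> \<epsilon> * r" using norm_ge_zero order_trans by blast
    then show ?thesis using r by (simp add: zero_le_mult_iff)
  qed
  define u1 where "u1 i x = (m x)\<^sup>2 * (V' x i \<bullet> i) - 4 * m x * (x \<bullet> i) * (V x \<bullet> i)" for i x
  have der: "((\<lambda>t. (m (x + t *\<^sub>R i))\<^sup>2 * (V (x + t *\<^sub>R i) \<bullet> i)) has_real_derivative u1 i (x + t *\<^sub>R i)) (at t)" for i x t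
  proof -
    let ?y = "\<lambda>t. x + t *\<^sub>R i"
    have dy: "(?y has_derivative (\<lambda>s. s *\<^sub>R i)) (at t)" by (auto intro!: derivative_eq_intros)
    have 1: "((\<lambda>t. r\<^sup>2 - ?y t \<bullet> ?y t) has_real_derivative - 2 * (?y t \<bullet> i)) (at t)"
    proof -
      have "((\<lambda>t. r\<^sup>2 - ?y t \<bullet> ?y t) has_derivative (\<lambda>s. - (?y t \<bullet> (s *\<^sub>R i) + (s *\<^sub>R i) \<bullet> ?y t))) (at t)"
        by (auto intro!: derivative_eq_intros dy)
      moreover have "(\<lambda>s. - (?y t \<bullet> (s *\<^sub>R i) + (s *\<^sub>R i) \<bullet> ?y t)) = (*) (- 2 * (?y t \<bullet> i))"
        by (simp add: fun_eq_iff inner_commute[of i])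
      ultimately show ?thesis unfolding has_field_derivative_def by simp
    qed
    have 2: "((\<lambda>t. (m (?y t))\<^sup>2) has_real_derivative (2 * m (?y t)) * (- 2 * (?y t \<bullet> i))) (at t)"
      unfolding m_def by (rule DERIV_chain2[OF has_real_derivative_max_0_squared 1])
    have 3: "((\<lambda>t. V (?y t) \<bullet> i) has_real_derivative V' (?y t) i \<bullet> i) (at t)"
    proof -
      have "((\<lambda>t. V (?y t) \<bullet> i) has_derivative (\<lambda>s. V' (?y t) (s *\<^sub>R i) \<bullet> i)) (at t)"
        by (rule has_derivative_inner_left[OF has_derivative_compose[OF dy dV]])
      then show ?thesis unfolding has_field_derivative_def
        by (simp add: linear_scale[OF has_derivative_linear[OF dV]] mult_commute_abs)
    qed
    show ?thesis using DERIV_mult[OF 2 3] by (simp add: u1_def algebra_simps)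
  qed
  have cu1: "continuous_on UNIV (u1 i)" if "i \<in> Basis" for i
    unfolding u1_def by (intro continuous_intros cm cV cV' that)
  have int0: "(LINT x|lborel. u1 i x) = 0" if "i \<in> Basis" for i
  proof (rule integral_directional_derivative_eq_0[OF der, where r = r])
    show "continuous_on UNIV (\<lambda>x. (m x)\<^sup>2 * (V x \<bullet> i))" by (intro continuous_intros cm cV)
    show "continuous_on UNIV (u1 i)" by (rule cu1[OF that])
  qed (use that in \<open>auto simp: sm u1_def\<close>)
  have iu1: "integrable lborel (u1 i)" if "i \<in> Basis" for i
    by (rule integrable_compact_support[OF cu1[OF that], where r = r]) (auto simp: sm u1_def)
  have im2: "integrable lborel (\<lambda>x. (m x)\<^sup>2)"
    by (rule integrable_compact_support[where r = r]) (auto intro!: continuous_intros cm simp: sm)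
  have sum_u1: "(\<Sum>i\<in>Basis. u1 i x) = \<kappa> * (m x)\<^sup>2 - 4 * m x * (x \<bullet> V x)" for x
  proof -
    have "(\<Sum>i\<in>Basis. u1 i x) = (m x)\<^sup>2 * (\<Sum>i\<in>Basis. V' x i \<bullet> i) - 4 * m x * (\<Sum>i\<in>Basis. (x \<bullet> i) * (V x \<bullet> i))"
      by (simp add: u1_def sum_subtractf sum_distrib_left mult.assoc)
    also have "(\<Sum>i\<in>Basis. (x \<bullet> i) * (V x \<bullet> i)) = x \<bullet> V x" by (rule euclidean_inner[symmetric])
    finally show ?thesis by (simp add: div mult.commute)
  qed
  define B where "B = measure lborel (cball (0::'a) r)"
  define b where "b = measure lborel (cball (0::'a) (r / 2))"
  have bB: "B = 2 ^ DIM('a) * b" and bpos: "b > 0"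
  proof -
    have "B = unit_ball_vol DIM('a) * r ^ DIM('a)" "b = unit_ball_vol DIM('a) * (r / 2) ^ DIM('a)"
      unfolding B_def b_def using r by (simp_all add: content_cball)
    then show "B = 2 ^ DIM('a) * b" "b > 0" using r by (simp_all add: power_divide unit_ball_vol_pos)
  qed
  have iind: "integrable lborel (\<lambda>x. a * indicator (cball (0::'a) s) x)" for a s :: real
    using emeasure_bounded_finite[OF bounded_cball]
    by (intro integrable_mult_right integrable_real_indicator) auto
  have iV: "integrable lborel (\<lambda>x. 4 * m x * (x \<bullet> V x))"
    by (rule integrable_compact_support[where r = r]) (auto intro!: continuous_intros cm cV simp: sm)
  have "0 = (LINT x|lborel. (\<Sum>i\<in>Basis. u1 i x))"
    using iu1 int0 by (subst Bochner_Integration.integral_sum) auto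
  also have "\<dots> = \<kappa> * (LINT x|lborel. (m x)\<^sup>2) - (LINT x|lborel. 4 * m x * (x \<bullet> V x))"
    unfolding sum_u1 using im2 iV by simp
  finally have eq: "\<kappa> * (LINT x|lborel. (m x)\<^sup>2) = (LINT x|lborel. 4 * m x * (x \<bullet> V x))" by simp
  have "(LINT x|lborel. 4 * m x * (x \<bullet> V x)) \<le> (LINT x|lborel. (4 * \<epsilon> * r^4) * indicator (cball (0::'a) r) x)"
  proof (rule integral_mono[OF iV iind])
    fix x :: 'a
    show "4 * m x * (x \<bullet> V x) \<le> (4 * \<epsilon> * r^4) * indicator (cball 0 r) x"
    proof (cases "x \<in> cball 0 r")
      case True
      have "x \<bullet> V x \<le> norm x * norm (V x)" by (rule norm_cauchy_schwarz)
      also have "\<dots> \<le> r * (\<epsilon> * r)" using True bd[OF True] r by (intro mult_mono) auto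
      finally have 1: "x \<bullet> V x \<le> \<epsilon> * r\<^sup>2" by (simp add: power2_eq_square ac_simps)
      have "m x * (x \<bullet> V x) \<le> m x * (\<epsilon> * r\<^sup>2)" by (rule mult_left_mono[OF 1]) (simp add: m_def)
      also have "\<dots> \<le> r\<^sup>2 * (\<epsilon> * r\<^sup>2)" using \<epsilon> by (intro mult_right_mono) (auto simp: m_def)
      finally have "m x * (x \<bullet> V x) \<le> \<epsilon> * r^4" by (simp add: power2_eq_square power4_eq_xxxx ac_simps)
      then show ?thesis using True by simp
    qed (simp add: sm)
  qed
  also have "\<dots> = 4 * \<epsilon> * r^4 * B" by (simp add: B_def)
  finally have up: "\<kappa> * (LINT x|lborel. (m x)\<^sup>2) \<le> 4 * \<epsilon> * r^4 * B" unfolding eq .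
  have "(LINT x|lborel. (r^4 / 2) * indicator (cball (0::'a) (r / 2)) x) \<le> (LINT x|lborel. (m x)\<^sup>2)"
  proof (rule integral_mono[OF iind im2])
    fix x :: 'a
    show "(r^4 / 2) * indicator (cball (0::'a) (r / 2)) x \<le> (m x)\<^sup>2"
    proof (cases "x \<in> cball 0 (r / 2)")
      case True
      then have "(norm x)\<^sup>2 \<le> (r / 2)\<^sup>2" by (intro power_mono) auto
      then have "x \<bullet> x \<le> r\<^sup>2 / 4" by (simp add: power2_norm_eq_inner power_divide)
      moreover have "m x \<ge> r\<^sup>2 - x \<bullet> x" by (simp add: m_def)
      ultimately have "m x \<ge> 3 / 4 * r\<^sup>2" by linarith
      then have "(m x)\<^sup>2 \<ge> (3 / 4 * r\<^sup>2)\<^sup>2" by (intro power_mono) auto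
      moreover have "(3 / 4 * r\<^sup>2)\<^sup>2 = 9 / 16 * r^4" by (simp add: power_mult_distrib power_divide power_mult[symmetric])
      moreover have "r^4 / 2 \<le> 9 / 16 * r^4" by simp
      ultimately have "r^4 / 2 \<le> (m x)\<^sup>2" by linarith
      then show ?thesis using True by simp
    qed simp
  qed
  then have "r^4 / 2 * b \<le> (LINT x|lborel. (m x)\<^sup>2)" by (simp add: b_def)
  then have "\<kappa> * (r^4 / 2 * b) \<le> \<kappa> * (LINT x|lborel. (m x)\<^sup>2)" using \<kappa> by (intro mult_left_mono)
  also note up
  finally have "(r^4 * b) * \<kappa> \<le> (r^4 * b) * (8 * 2 ^ DIM('a) * \<epsilon>)" unfolding bB by (simp add: ac_simps)
  then show ?thesis using bpos r by simp
qed

section \<open>A maximum principle and an algebraic inequality\<close>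

lemma second_derivative_at_maximum:
  fixes \<phi> :: "real \<Rightarrow> real"
  assumes d1: "\<And>t. (\<phi> has_real_derivative \<phi>1 t) (at t)"
    and d2: "(\<phi>1 has_real_derivative d) (at 0)"
    and \<epsilon>: "\<epsilon> > 0" and max: "\<And>t. \<bar>t\<bar> < \<epsilon> \<Longrightarrow> \<phi> t \<le> \<phi> 0"
  shows "\<phi>1 0 = 0" "d \<le> 0"
proof -
  show z: "\<phi>1 0 = 0"
    by (rule DERIV_local_max[OF d1 \<epsilon>]) (auto intro: max)
  show "d \<le> 0"
  proof (rule ccontr)
    assume "\<not> d \<le> 0"
    then obtain \<delta> where \<delta>: "\<delta> > 0" "\<And>h. 0 < h \<Longrightarrow> h < \<delta> \<Longrightarrow> \<phi>1 0 < \<phi>1 h"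
      using DERIV_pos_inc_right[OF d2] by auto
    define h where "h = min \<delta> \<epsilon> / 2"
    have h: "0 < h" "h < \<delta>" "h < \<epsilon>" using \<delta>(1) \<epsilon> by (auto simp: h_def)
    obtain s where s: "0 < s" "s < h" "\<phi> h - \<phi> 0 = (h - 0) * \<phi>1 s"
      using MVT2[OF h(1) d1] by blast
    then have "\<phi>1 s > 0" using \<delta>(2)[of s] h z by simp
    then have "\<phi> h > \<phi> 0" using s(3) h(1) by (simp add: algebra_simps)
    then show False using max[of h] h by auto
  qed
qed

text \<open>
  The orders of summation in which the quartic expressions of the next inequality factorize.
\<close>

lemma sum_permute6:
  fixes F :: "'p::finite \<Rightarrow> 'p \<Rightarrow> 'p \<Rightarrow> 'p \<Rightarrow> 'a::finite \<Rightarrow> 'a \<Rightarrow> real"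
  shows "(\<Sum>p\<in>UNIV. \<Sum>q\<in>UNIV. \<Sum>r\<in>UNIV. \<Sum>s\<in>UNIV. \<Sum>a\<in>UNIV. \<Sum>b\<in>UNIV. F p q r s a b) =
      (\<Sum>a\<in>UNIV. \<Sum>b\<in>UNIV. \<Sum>p\<in>UNIV. \<Sum>q\<in>UNIV. \<Sum>s\<in>UNIV. \<Sum>r\<in>UNIV. F p q r s a b)" (is ?A)
    and "(\<Sum>p\<in>UNIV. \<Sum>q\<in>UNIV. \<Sum>r\<in>UNIV. \<Sum>s\<in>UNIV. \<Sum>a\<in>UNIV. \<Sum>b\<in>UNIV. F p q r s a b) =
      (\<Sum>a\<in>UNIV. \<Sum>b\<in>UNIV. \<Sum>p\<in>UNIV. \<Sum>r\<in>UNIV. \<Sum>s\<in>UNIV. \<Sum>q\<in>UNIV. F p q r s a b)" (is ?B)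
    and "(\<Sum>p\<in>UNIV. \<Sum>q\<in>UNIV. \<Sum>r\<in>UNIV. \<Sum>s\<in>UNIV. \<Sum>a\<in>UNIV. \<Sum>b\<in>UNIV. F p q r s a b) =
      (\<Sum>a\<in>UNIV. \<Sum>b\<in>UNIV. \<Sum>p\<in>UNIV. \<Sum>s\<in>UNIV. \<Sum>q\<in>UNIV. \<Sum>r\<in>UNIV. F p q r s a b)" (is ?C)
proof -
  show ?A unfolding sum.cartesian_product
    by (rule sum.reindex_bij_witness[where i = "\<lambda>(a,b,p,q,s,r). (p,q,r,s,a,b)" and j = "\<lambda>(p,q,r,s,a,b). (a,b,p,q,s,r)"]) auto
  show ?B unfolding sum.cartesian_product
    by (rule sum.reindex_bij_witness[where i = "\<lambda>(a,b,p,r,s,q). (p,q,r,s,a,b)" and j = "\<lambda>(p,q,r,s,a,b). (a,b,p,r,s,q)"]) auto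
  show ?C unfolding sum.cartesian_product
    by (rule sum.reindex_bij_witness[where i = "\<lambda>(a,b,p,s,q,r). (p,q,r,s,a,b)" and j = "\<lambda>(p,q,r,s,a,b). (a,b,p,s,q,r)"]) auto
qed

lemma sum_rotate3:
  "(\<Sum>p\<in>A. \<Sum>q\<in>B. \<Sum>r\<in>C. F p q r) = (\<Sum>q\<in>B. \<Sum>r\<in>C. \<Sum>p\<in>A. F p q r)"
  by (subst sum.swap) (intro sum.cong refl sum.swap)

text \<open>
  The quartic expression in the Simons formula. With \<open>X = A\<^sub>a A\<^sub>b\<close>, the first and the third term
  both sum to the squared norms of all \<open>X\<close>, and the second subtracts twice the traces of \<open>X\<^sup>2\<close>;
  together these three give the squared norms of all commutators \<open>A\<^sub>a A\<^sub>b - A\<^sub>b A\<^sub>a\<close>. The last term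
  is the sum of the squares of all inner products of \<open>A\<^sub>a\<close> with \<open>A\<^sub>b\<close>, to which the diagonal
  \<open>a = b\<close> already contributes at least the left-hand side, by the Cauchy-Schwarz inequality.
\<close>

lemma simons_quartic_inequality:
  fixes A :: "'n::finite \<Rightarrow> 'm::finite \<Rightarrow> 'm \<Rightarrow> real"
  assumes sym: "\<And>a p q. A a p q = A a q p"
  defines "c \<equiv> \<lambda>p q r s. \<Sum>a\<in>UNIV. A a p q * A a r s"
  shows "(\<Sum>p\<in>UNIV. \<Sum>q\<in>UNIV. c p q p q)\<^sup>2 / CARD('n) \<le>
    (\<Sum>p\<in>UNIV. \<Sum>q\<in>UNIV. \<Sum>r\<in>UNIV. \<Sum>s\<in>UNIV.
      c p s p r * c q s q r - 2 * (c q s p r * c p s q r) + c p s q p * c s r q r + (c p s q r)\<^sup>2)"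
proof -
  define X where "X a b p q = (\<Sum>s\<in>UNIV. A a p s * A b q s)" for a b p q
  define Z where "Z a b = (\<Sum>p\<in>UNIV. \<Sum>q\<in>UNIV. A a p q * A b p q)" for a b
  have cc: "c p q r s * c p' q' r' s' = (\<Sum>a\<in>UNIV. \<Sum>b\<in>UNIV. (A a p q * A a r s) * (A b p' q' * A b r' s'))"
    for p q r s p' q' r' s' unfolding c_def by (rule sum_product)
  \<comment> \<open>The sums \<open>J1\<close> and \<open>J3\<close> are the squared norms of the products, \<open>J2\<close> the traces of their squares.\<close>
  have J1: "(\<Sum>p\<in>UNIV. \<Sum>q\<in>UNIV. \<Sum>r\<in>UNIV. \<Sum>s\<in>UNIV. c p s p r * c q s q r) =
      (\<Sum>a\<in>UNIV. \<Sum>b\<in>UNIV. \<Sum>p\<in>UNIV. \<Sum>q\<in>UNIV. (X a b p q)\<^sup>2)"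
    unfolding cc sum_permute6(1) power2_eq_square X_def sum_product
    by (intro sum.cong refl) (simp add: ac_simps)
  have J2: "(\<Sum>p\<in>UNIV. \<Sum>q\<in>UNIV. \<Sum>r\<in>UNIV. \<Sum>s\<in>UNIV. c q s p r * c p s q r) =
      (\<Sum>a\<in>UNIV. \<Sum>b\<in>UNIV. \<Sum>p\<in>UNIV. \<Sum>q\<in>UNIV. X a b q p * X a b p q)"
    unfolding cc sum_permute6(1) X_def sum_product
    by (intro sum.cong refl) (simp add: ac_simps)
  have J3: "(\<Sum>p\<in>UNIV. \<Sum>q\<in>UNIV. \<Sum>r\<in>UNIV. \<Sum>s\<in>UNIV. c p s q p * c s r q r) =
      (\<Sum>a\<in>UNIV. \<Sum>b\<in>UNIV. \<Sum>p\<in>UNIV. \<Sum>q\<in>UNIV. (X a b p q)\<^sup>2)"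
    unfolding cc sum_permute6(2) power2_eq_square X_def sum_product
    by (intro sum.cong refl) (simp add: ac_simps sym)
  have J4: "(\<Sum>p\<in>UNIV. \<Sum>q\<in>UNIV. \<Sum>r\<in>UNIV. \<Sum>s\<in>UNIV. (c p s q r)\<^sup>2) =
      (\<Sum>a\<in>UNIV. \<Sum>b\<in>UNIV. (Z a b)\<^sup>2)"
    unfolding power2_eq_square cc sum_permute6(3) Z_def sum_product sum_distrib_left sum_distrib_right
    by (intro sum.cong refl) (simp add: ac_simps)
  have swap: "(\<Sum>p\<in>UNIV. \<Sum>q\<in>UNIV. (X a b q p)\<^sup>2) = (\<Sum>p\<in>UNIV. \<Sum>q\<in>UNIV. (X a b p q)\<^sup>2)" for a b
    by (rule sum.swap)
  have "0 \<le> (\<Sum>a\<in>UNIV. \<Sum>b\<in>UNIV. \<Sum>p\<in>UNIV. \<Sum>q\<in>UNIV. (X a b p q - X a b q p)\<^sup>2)"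
    by (intro sum_nonneg) simp
  also have "\<dots> = 2 * (\<Sum>a\<in>UNIV. \<Sum>b\<in>UNIV. \<Sum>p\<in>UNIV. \<Sum>q\<in>UNIV. (X a b p q)\<^sup>2)
      - 2 * (\<Sum>a\<in>UNIV. \<Sum>b\<in>UNIV. \<Sum>p\<in>UNIV. \<Sum>q\<in>UNIV. X a b q p * X a b p q)"
    unfolding power2_diff sum_subtractf sum.distrib swap
    by (simp add: sum_distrib_left ac_simps)
  finally have comm: "0 \<le> (\<Sum>p\<in>UNIV. \<Sum>q\<in>UNIV. \<Sum>r\<in>UNIV. \<Sum>s\<in>UNIV.
      c p s p r * c q s q r - 2 * (c q s p r * c p s q r) + c p s q p * c s r q r)"
    unfolding sum_subtractf sum.distrib sum_distrib_left[symmetric] J1 J2 J3 by simp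
  have "(\<Sum>p\<in>UNIV. \<Sum>q\<in>UNIV. c p q p q) = (\<Sum>a\<in>UNIV. Z a a)"
    unfolding c_def Z_def by (subst sum.swap[of _ _ UNIV], intro sum.cong refl sum.swap)
  then have "(\<Sum>p\<in>UNIV. \<Sum>q\<in>UNIV. c p q p q)\<^sup>2 \<le> (\<Sum>a\<in>(UNIV::'n set). 1\<^sup>2) * (\<Sum>a\<in>UNIV. (Z a a)\<^sup>2)"
    using Cauchy_Schwarz_ineq_sum[of "\<lambda>_. 1" "\<lambda>a. Z a a" UNIV] by simp
  also have "\<dots> \<le> CARD('n) * (\<Sum>a\<in>UNIV. \<Sum>b\<in>UNIV. (Z a b)\<^sup>2)"
  proof -
    have "(Z a a)\<^sup>2 \<le> (\<Sum>b\<in>UNIV. (Z a b)\<^sup>2)" for a by (rule member_le_sum) auto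
    then show ?thesis by (simp add: sum_mono)
  qed
  finally have "(\<Sum>p\<in>UNIV. \<Sum>q\<in>UNIV. c p q p q)\<^sup>2 / CARD('n) \<le> (\<Sum>a\<in>UNIV. \<Sum>b\<in>UNIV. (Z a b)\<^sup>2)"
    by (simp add: divide_le_eq mult.commute)
  then show ?thesis
    using comm unfolding J4[symmetric] by (simp add: sum.distrib)
qed

section \<open>The metric and the normal bundle of a space-like graph\<close>

text \<open>
  Everything is expressed in the global coordinates of the graph. Tensors are functions of a
  point followed by vector arguments in which they are linear; directions \<open>h\<close>, \<open>u\<close>, \<open>v\<close>, \<open>w\<close> are
  constant vectors of the coordinate space.
\<close>

locale spacelike_graph =
  fixes f :: "real^'m \<Rightarrow> real^'n"
  assumes smooth: "smooth_map f" and spacelike: "spacelike (graph_param f)"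
begin

definition df where "df x u = dir_deriv u f x"
definition d2f where "d2f x u v = dir_deriv u (dir_deriv v f) x"
definition d3f where "d3f x u v w = dir_deriv u (dir_deriv v (dir_deriv w f)) x"
definition d4f where "d4f x t u v w = dir_deriv t (dir_deriv u (dir_deriv v (dir_deriv w f))) x"

lemmas smooth_derivs = smooth smooth_map_dir_deriv

lemma has_derivative_df: "((\<lambda>x. df x u) has_derivative (\<lambda>h. d2f x h u)) (at x)"
  unfolding df_def d2f_def
  by (intro dir_deriv_has_derivative smooth_map_differentiable smooth_derivs)

lemma has_derivative_d2f: "((\<lambda>x. d2f x u v) has_derivative (\<lambda>h. d3f x h u v)) (at x)"
  unfolding d2f_def d3f_def
  by (intro dir_deriv_has_derivative smooth_map_differentiable smooth_derivs)

lemma has_derivative_d3f: "((\<lambda>x. d3f x u v w) has_derivative (\<lambda>h. d4f x h u v w)) (at x)"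
  unfolding d3f_def d4f_def
  by (intro dir_deriv_has_derivative smooth_map_differentiable smooth_derivs)

lemma d2f_commute: "d2f x u v = d2f x v u"
  unfolding d2f_def using dir_deriv_commute[OF smooth] by metis

lemma d3f_commute12: "d3f x u v w = d3f x v u w"
  unfolding d3f_def using dir_deriv_commute[OF smooth_map_dir_deriv[OF smooth]] by metis

lemma d3f_commute23: "d3f x u v w = d3f x u w v"
  unfolding d3f_def using dir_deriv_commute[OF smooth] by metis

lemma d4f_commute12: "d4f x t u v w = d4f x u t v w"
  unfolding d4f_def using dir_deriv_commute[OF smooth_map_dir_deriv[OF smooth_map_dir_deriv[OF smooth]]] by metis

lemma linear_df: "linear (df x)"
  unfolding df_def by (intro linear_dir_deriv smooth_map_differentiable smooth)

lemma linear_d2f1: "linear (\<lambda>u. d2f x u v)"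
  unfolding d2f_def by (intro linear_dir_deriv smooth_map_differentiable smooth_derivs)

lemma linear_d2f2: "linear (d2f x u)"
proof -
  have "d2f x u = (\<lambda>v. d2f x v u)" by (rule ext) (rule d2f_commute)
  then show ?thesis using linear_d2f1 by simp
qed

lemma linear_d3f1: "linear (\<lambda>u. d3f x u v w)"
  unfolding d3f_def by (intro linear_dir_deriv smooth_map_differentiable smooth_derivs)

lemma linear_d3f2: "linear (\<lambda>v. d3f x u v w)"
  using linear_d3f1[of x u w] by (simp add: d3f_commute12[of x u])

lemma linear_d3f3: "linear (\<lambda>w. d3f x u v w)"
  using linear_d3f2[of x u v] by (simp add: d3f_commute23[of x u v])

lemmas derivative_linear = linear_add[OF linear_df] linear_scale[OF linear_df] linear_neg[OF linear_df]
  linear_diff[OF linear_df] linear_0[OF linear_df]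
  linear_add[OF linear_d2f1] linear_scale[OF linear_d2f1] linear_neg[OF linear_d2f1]
  linear_diff[OF linear_d2f1] linear_0[OF linear_d2f1]
  linear_add[OF linear_d2f2] linear_scale[OF linear_d2f2] linear_neg[OF linear_d2f2]
  linear_diff[OF linear_d2f2] linear_0[OF linear_d2f2]
  linear_add[OF linear_d3f1] linear_scale[OF linear_d3f1]
  linear_add[OF linear_d3f2] linear_scale[OF linear_d3f2]
  linear_add[OF linear_d3f3] linear_scale[OF linear_d3f3]

definition dft where "dft x = adjoint (df x)"
definition d2ft where "d2ft x h = adjoint (d2f x h)"

lemma dft_inner: "dft x a \<bullet> u = a \<bullet> df x u" "u \<bullet> dft x a = df x u \<bullet> a"
  unfolding dft_def using adjoint_clauses[OF linear_df] by auto

lemma d2ft_inner: "d2ft x h a \<bullet> u = a \<bullet> d2f x h u" "u \<bullet> d2ft x h a = d2f x h u \<bullet> a"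
  unfolding d2ft_def using adjoint_clauses[OF linear_d2f2] by auto

lemma linear_dft: "linear (dft x)"
  unfolding dft_def by (rule adjoint_linear[OF linear_df])

lemma linear_d2ft: "linear (d2ft x h)"
  unfolding d2ft_def by (rule adjoint_linear[OF linear_d2f2])

lemma has_derivative_dft: "((\<lambda>x. dft x a) has_derivative (\<lambda>h. d2ft x h a)) (at x)"
proof -
  have "((\<lambda>x. \<Sum>i\<in>Basis. (a \<bullet> df x i) *\<^sub>R i) has_derivative (\<lambda>h. \<Sum>i\<in>Basis. (a \<bullet> d2f x h i) *\<^sub>R i)) (at x)"
    by (intro has_derivative_sum has_derivative_scaleR_left has_derivative_inner_right has_derivative_df)
  moreover have "dft x a = (\<Sum>i\<in>Basis. (a \<bullet> df x i) *\<^sub>R i)" for x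
    using euclidean_representation[of "dft x a"] by (simp only: dft_inner)
  moreover have "d2ft x h a = (\<Sum>i\<in>Basis. (a \<bullet> d2f x h i) *\<^sub>R i)" for h
    using euclidean_representation[of "d2ft x h a"] by (simp only: d2ft_inner)
  ultimately show ?thesis by simp
qed

text \<open>
  The induced metric as a self-adjoint operator.
\<close>

definition gram where "gram x v = v - dft x (df x v)"

lemma linear_gram: "linear (gram x)"
  unfolding gram_def
  by (intro linear_compose_sub linear_id[unfolded id_def] linear_compose[OF linear_df linear_dft, unfolded o_def])

lemma gram_inner: "gram x u \<bullet> v = u \<bullet> v - df x u \<bullet> df x v"
  by (simp add: gram_def inner_diff_left dft_inner)

lemma gram_symmetric: "gram x u \<bullet> v = u \<bullet> gram x v"
  unfolding gram_inner inner_commute[of u "gram x v"] by (simp add: inner_commute)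

lemma dir_deriv_graph: "dir_deriv u (graph_param f) x = (u, df x u)"
  unfolding df_def by (rule dir_deriv_graph_param[OF smooth_map_differentiable[OF smooth]])

lemma induced_metric_gram: "induced_metric (graph_param f) x u v = gram x u \<bullet> v"
  by (simp add: induced_metric_def dir_deriv_graph pinner_def gram_inner)

lemma gram_pos: "u \<noteq> 0 \<Longrightarrow> gram x u \<bullet> u > 0"
  using spacelike unfolding spacelike_def induced_metric_gram by blast

lemma bij_gram: "bij (gram x)"
proof -
  have "inj (gram x)"
    unfolding linear_injective_0[OF linear_gram] by (metis gram_pos inner_zero_left less_irrefl)
  then show ?thesis
    using linear_injective_imp_surjective[OF linear_gram] by (auto simp: bij_def)
qed

definition G where "G x = inv (gram x)"

lemma gram_G [simp]: "gram x (G x v) = v" and G_gram [simp]: "G x (gram x v) = v"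
  unfolding G_def using bij_gram by (simp_all add: bij_def surj_f_inv_f)

lemma linear_G: "linear (G x)"
proof (rule linearI)
  show "G x (u + v) = G x u + G x v" for u v
    using linear_add[OF linear_gram, of x "G x u" "G x v"] G_gram[of x "G x u + G x v"] by simp
  show "G x (r *\<^sub>R v) = r *\<^sub>R G x v" for r v
    using linear_scale[OF linear_gram, of x r "G x v"] G_gram[of x "r *\<^sub>R G x v"] by simp
qed

lemma G_symmetric: "G x u \<bullet> v = u \<bullet> G x v"
  using gram_symmetric[of x "G x u" "G x v"] by simp

lemma G_pos: "G x v \<bullet> v \<ge> 0"
  using gram_pos[of "G x v" x] by (cases "G x v = 0") (auto simp: inner_commute)

lemma has_derivative_gram:
  "((\<lambda>x. gram x v) has_derivative (\<lambda>h. - (d2ft x h (df x v) + dft x (d2f x h v)))) (at x)"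
proof -
  have "((\<lambda>x. dft x (df x v)) has_derivative (\<lambda>h. d2ft x h (df x v) + dft x (d2f x h v))) (at x)"
    by (rule has_derivative_linear_family[OF linear_dft has_derivative_dft has_derivative_df])
  then show ?thesis unfolding gram_def
    by (auto intro!: derivative_eq_intros)
qed

lemma matrix_gram: "matrix (gram x) *v u = gram x u"
  by (rule matrix_works) (simp add: linear_matrix_vector_mul_eq linear_gram)

lemma matrix_gram_entry: "matrix (gram x) $ i $ j = gram x (axis j 1) $ i"
  by (simp add: matrix_def)

lemma det_gram_nonzero: "det (matrix (gram x)) \<noteq> 0"
proof -
  have "inj ((*v) (matrix (gram x)))"
    using bij_gram[of x] by (simp add: matrix_gram bij_def inj_on_def)
  then show ?thesis
    by (simp add: invertible_det_nz[symmetric] invertible_left_inverse matrix_left_invertible_injective)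
qed

text \<open>
  Cramer's rule shows that the inverse metric is differentiable. Its derivative is then found
  by differentiating \<open>gram x (G x v) = v\<close>.
\<close>

lemma G_cramer:
  "G x v = (\<chi> k. det (\<chi> i j. if j = k then v $ i else matrix (gram x) $ i $ j) / det (matrix (gram x)))"
  using cramer[OF det_gram_nonzero, of x "G x v" v] by (simp add: matrix_gram)

lemma differentiable_gram_entry: "(\<lambda>x. matrix (gram x) $ i $ j) differentiable (at x)"
  unfolding matrix_gram_entry
  by (rule differentiableI)
    (rule bounded_linear.has_derivative[OF bounded_linear_vec_nth has_derivative_gram])

lemma differentiable_G: "(\<lambda>x. G x v) differentiable (at x)"
  unfolding G_cramer
proof (intro differentiable_vec_lambda differentiable_divide differentiable_det det_gram_nonzero
    differentiable_gram_entry)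
  fix k i j :: 'm
  show "(\<lambda>y. (\<chi> i j. if j = k then v $ i else matrix (gram y) $ i $ j) $ i $ j) differentiable at x"
    by (cases "j = k") (auto intro: differentiable_gram_entry)
qed

text \<open>
  The normal component of \<open>(0, a)\<close> is \<open>(Y x a, K x a)\<close>, so that the normal space at \<open>x\<close> is
  parametrized by \<open>a\<close>; the ambient form of two such normal vectors is \<open>- a \<bullet> K x c\<close>.
\<close>

definition Y where "Y x a = G x (dft x a)"
definition K where "K x a = a + df x (Y x a)"

lemma linear_Y: "linear (Y x)"
  unfolding Y_def by (rule linear_compose[OF linear_dft linear_G, unfolded o_def])

lemma linear_K: "linear (K x)"
  unfolding K_def
  by (intro linear_compose_add linear_id[unfolded id_def] linear_compose[OF linear_Y linear_df, unfolded o_def])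

lemmas operator_linear = derivative_linear
  linear_add[OF linear_G] linear_neg[OF linear_G] linear_diff[OF linear_G] linear_scale[OF linear_G] linear_0[OF linear_G]
  linear_add[OF linear_Y] linear_neg[OF linear_Y] linear_diff[OF linear_Y] linear_scale[OF linear_Y] linear_0[OF linear_Y]
  linear_add[OF linear_K] linear_neg[OF linear_K] linear_diff[OF linear_K] linear_scale[OF linear_K] linear_0[OF linear_K]
  linear_add[OF linear_dft] linear_neg[OF linear_dft] linear_diff[OF linear_dft] linear_scale[OF linear_dft] linear_0[OF linear_dft]
  linear_add[OF linear_d2ft] linear_neg[OF linear_d2ft] linear_diff[OF linear_d2ft] linear_scale[OF linear_d2ft] linear_0[OF linear_d2ft]

lemma dft_df: "dft x (df x v) = v - gram x v"
  by (simp add: gram_def)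

lemma dft_K: "dft x (K x a) = Y x a"
proof -
  have "dft x (K x a) = gram x (Y x a) + dft x (df x (Y x a))"
    by (simp add: K_def Y_def operator_linear)
  then show ?thesis by (simp add: dft_df)
qed

lemma Y_inner: "Y x a \<bullet> v = a \<bullet> df x (G x v)" "v \<bullet> Y x a = df x (G x v) \<bullet> a"
  by (simp_all only: Y_def G_symmetric dft_inner G_symmetric[of x v, symmetric])

lemma K_inner: "K x a \<bullet> c = a \<bullet> c + G x (dft x a) \<bullet> dft x c"
  by (simp add: K_def Y_def inner_add_left dft_inner)

lemma K_symmetric: "K x a \<bullet> c = a \<bullet> K x c"
proof -
  have "K x a \<bullet> c = c \<bullet> a + dft x c \<bullet> G x (dft x a)"
    unfolding K_inner inner_commute[of a c] inner_commute[of "dft x c"] ..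
  also have "\<dots> = K x c \<bullet> a" by (simp only: K_inner G_symmetric)
  finally show ?thesis by (simp only: inner_commute)
qed

text \<open>
  The normal spaces are time-like.
\<close>

lemma K_ge: "K x a \<bullet> a \<ge> a \<bullet> a"
  using G_pos[of x "dft x a"] by (simp add: K_inner)

text \<open>
  The two summands are adjoint to each other: they are the terms of the
  Levi-Civita connection, whose Christoffel symbols are \<open>- Y x (d2f x h u)\<close>.
\<close>

lemma has_derivative_G:
  "((\<lambda>x. G x v) has_derivative (\<lambda>h. Y x (d2f x h (G x v)) + G x (d2ft x h (df x (G x v))))) (at x)"
proof -
  obtain G' where G': "((\<lambda>x. G x v) has_derivative G') (at x)"
    using differentiable_G unfolding differentiable_def by blast
  have "((\<lambda>x. gram x (G x v)) has_derivative
      (\<lambda>h. - (d2ft x h (df x (G x v)) + dft x (d2f x h (G x v))) + gram x (G' h))) (at x)"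
    by (rule has_derivative_linear_family[OF linear_gram has_derivative_gram G'])
  moreover have "((\<lambda>x. gram x (G x v)) has_derivative (\<lambda>h. 0)) (at x)" by simp
  ultimately have "(\<lambda>h. - (d2ft x h (df x (G x v)) + dft x (d2f x h (G x v))) + gram x (G' h)) = (\<lambda>h. 0)"
    by (rule has_derivative_unique)
  then have "- (d2ft x h (df x (G x v)) + dft x (d2f x h (G x v))) + gram x (G' h) = 0" for h
    by (rule fun_cong)
  then have "gram x (G' h) = d2ft x h (df x (G x v)) + dft x (d2f x h (G x v))" for h
    by (simp add: algebra_simps eq_neg_iff_add_eq_0)
  then have "G' h = G x (d2ft x h (df x (G x v)) + dft x (d2f x h (G x v)))" for h
    using G_gram by metis
  then have "G' h = Y x (d2f x h (G x v)) + G x (d2ft x h (df x (G x v)))" for h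
    by (simp add: Y_def operator_linear)
  then show ?thesis using G' by presburger
qed

text \<open>
  This formula and the next one are the Weingarten equation: the derivative of the normal field
  \<open>(Y a, K a)\<close> is the normal field belonging to \<open>d2f x h (Y x a)\<close>, which is the connection form of
  the normal bundle, plus the tangent vector represented by \<open>G x (d2ft x h (K x a))\<close>.
\<close>

lemma has_derivative_Y:
  "((\<lambda>x. Y x a) has_derivative (\<lambda>h. Y x (d2f x h (Y x a)) + G x (d2ft x h (K x a)))) (at x)"
proof -
  have "((\<lambda>x. Y x a) has_derivative
    (\<lambda>h. (Y x (d2f x h (G x (dft x a))) + G x (d2ft x h (df x (G x (dft x a))))) + G x (d2ft x h a))) (at x)"
    unfolding Y_def[of _ a]
    by (rule has_derivative_linear_family[OF linear_G has_derivative_G has_derivative_dft])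
  then show ?thesis
    by (simp add: K_def operator_linear Y_def[of x a, symmetric] ac_simps)
qed

lemma has_derivative_K:
  "((\<lambda>x. K x a) has_derivative (\<lambda>h. K x (d2f x h (Y x a)) + df x (G x (d2ft x h (K x a))))) (at x)"
proof -
  have "((\<lambda>x. df x (Y x a)) has_derivative
    (\<lambda>h. d2f x h (Y x a) + df x (Y x (d2f x h (Y x a)) + G x (d2ft x h (K x a))))) (at x)"
    by (rule has_derivative_linear_family[OF linear_df has_derivative_df has_derivative_Y])
  then have "((\<lambda>x. a + df x (Y x a)) has_derivative
    (\<lambda>h. d2f x h (Y x a) + df x (Y x (d2f x h (Y x a)) + G x (d2ft x h (K x a))))) (at x)"
    by (auto intro!: derivative_eq_intros)
  then show ?thesis
    unfolding K_def[of _ a] K_def[of x "d2f _ _ _"] by (simp add: operator_linear add.assoc K_def)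
qed

section \<open>Covariant differentiation\<close>

text \<open>
  Contraction with the inverse metric.
\<close>

definition trace_g where "trace_g x \<Phi> = (\<Sum>i\<in>Basis. \<Phi> (G x i) i)"

text \<open>
  The inner product of tensors with values in the normal bundle. The sign of the
  time-like normal form is reversed, so that the inner product is positive.
\<close>

definition tensor_inner where
  "tensor_inner x \<Phi> \<Psi> = (\<Sum>i\<in>Basis. \<Sum>j\<in>Basis. \<Phi> (G x i) (G x j) \<bullet> K x (\<Psi> i j))"

text \<open>
  This says that \<open>e\<close> is an orthonormal basis for the induced metric at \<open>x\<close>, in the form in which it
  turns contractions into sums over the frame.
\<close>

definition frame :: "real^'m \<Rightarrow> ('m \<Rightarrow> real^'m) \<Rightarrow> bool" where
  "frame x e \<longleftrightarrow> (\<forall>v. G x v = (\<Sum>p\<in>UNIV. (v \<bullet> e p) *\<^sub>R e p))"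

lemma trace_g_frame:
  assumes M: "bilinear M" and e: "frame x e"
  shows "trace_g x M = (\<Sum>p\<in>UNIV. M (e p) (e p))"
proof -
  have "trace_g x M = (\<Sum>i\<in>Basis. \<Sum>p\<in>UNIV. (i \<bullet> e p) *\<^sub>R M (e p) i)"
    unfolding trace_g_def
    using e bilinear_linear(2)[OF M]
    by (simp add: frame_def linear_sum[OF bilinear_linear(2)[OF M]] linear_scale[OF bilinear_linear(2)[OF M]])
  also have "\<dots> = (\<Sum>p\<in>UNIV. \<Sum>i\<in>Basis. (i \<bullet> e p) *\<^sub>R M (e p) i)" by (rule sum.swap)
  also have "\<dots> = (\<Sum>p\<in>UNIV. M (e p) (e p))"
    by (simp only: inner_commute[of _ "e _"] linear_expand_Basis[OF bilinear_linear(1)[OF M], symmetric])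
  finally show ?thesis .
qed

lemma bilinear_compose_inner_K:
  assumes "bilinear \<Phi>" "bilinear \<Psi>"
  shows "bilinear (\<lambda>u v. \<Phi> u a \<bullet> K x (\<Psi> v c))" "bilinear (\<lambda>u v. \<Phi> a u \<bullet> K x (\<Psi> c v))"
  by (intro bilinear_inner_linear bilinear_linear assms linear_compose[OF _ linear_K, unfolded o_def])+

lemma tensor_inner_frame:
  assumes \<Phi>: "bilinear \<Phi>" and \<Psi>: "bilinear \<Psi>" and e: "frame x e"
  shows "tensor_inner x \<Phi> \<Psi> = (\<Sum>p\<in>UNIV. \<Sum>q\<in>UNIV. \<Phi> (e p) (e q) \<bullet> K x (\<Psi> (e p) (e q)))"
proof -
  have "tensor_inner x \<Phi> \<Psi> = (\<Sum>i\<in>Basis. trace_g x (\<lambda>u v. \<Phi> (G x i) u \<bullet> K x (\<Psi> i v)))"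
    by (simp add: tensor_inner_def trace_g_def)
  also have "\<dots> = (\<Sum>i\<in>Basis. \<Sum>q\<in>UNIV. \<Phi> (G x i) (e q) \<bullet> K x (\<Psi> i (e q)))"
    by (simp add: trace_g_frame[OF bilinear_compose_inner_K(2)[OF \<Phi> \<Psi>] e])
  also have "\<dots> = (\<Sum>q\<in>UNIV. trace_g x (\<lambda>u v. \<Phi> u (e q) \<bullet> K x (\<Psi> v (e q))))"
    by (simp add: trace_g_def) (rule sum.swap)
  also have "\<dots> = (\<Sum>q\<in>UNIV. \<Sum>p\<in>UNIV. \<Phi> (e p) (e q) \<bullet> K x (\<Psi> (e p) (e q)))"
    by (simp add: trace_g_frame[OF bilinear_compose_inner_K(1)[OF \<Phi> \<Psi>] e])
  finally show ?thesis by (subst sum.swap)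
qed

lemma bilinear_d2f: "bilinear (d2f x)"
  unfolding bilinear_def using linear_d2f1 linear_d2f2 by blast

text \<open>
  Covariant derivatives in direction \<open>h\<close> of a tensor \<open>\<phi>\<close> whose coordinate derivative in
  direction \<open>h\<close> is \<open>\<phi>'\<close>. The terms with \<open>\<phi>\<close> come from the Christoffel symbols
  \<open>- Y x (d2f x h u)\<close>; \<open>cov\<close> adds the connection form of the normal bundle.
\<close>

definition cov0 where
  "cov0 x h \<phi> \<phi>' u v = \<phi>' u v + \<phi> (Y x (d2f x h u)) v + \<phi> u (Y x (d2f x h v))"

definition cov where
  "cov x h \<phi> \<phi>' u v = cov0 x h \<phi> \<phi>' u v + d2f x h (Y x (\<phi> u v))"

lemma adjoint_Y_d2f: "d2ft x h (df x (G x u)) \<bullet> v = u \<bullet> Y x (d2f x h v)"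
  by (simp add: d2ft_inner Y_inner)

text \<open>
  Differentiating \<open>G\<close> produces two terms. One is a Christoffel correction in the first slot as it
  stands, the other becomes one in the second slot after passing to the adjoint.
\<close>

lemma has_derivative_trace_g:
  assumes \<Phi>: "\<And>y. bilinear (\<Phi> y)"
    and d\<Phi>: "\<And>u v. ((\<lambda>y. \<Phi> y u v) has_derivative (\<lambda>h. \<Phi>' h u v)) (at x)"
  shows "((\<lambda>y. trace_g y (\<Phi> y)) has_derivative (\<lambda>h. trace_g x (cov0 x h (\<Phi> x) (\<Phi>' h)))) (at x)"
proof -
  let ?N = "\<lambda>h i. d2ft x h (df x (G x i))"
  have "((\<lambda>y. trace_g y (\<Phi> y)) has_derivative (\<lambda>h. \<Sum>i\<in>Basis. \<Phi>' h (G x i) i + \<Phi> x (G x i) 0 +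
      \<Phi> x (Y x (d2f x h (G x i)) + G x (?N h i)) i)) (at x)"
    unfolding trace_g_def
    by (intro has_derivative_sum has_derivative_bilinear_family[OF \<Phi> d\<Phi> has_derivative_G has_derivative_const])
  moreover have "(\<Sum>i\<in>Basis. \<Phi> x (G x (?N h i)) i) = (\<Sum>i\<in>Basis. \<Phi> x (G x i) (Y x (d2f x h i)))" for h
  proof (rule sum_Basis_adjoint)
    show "bilinear (\<lambda>u v. \<Phi> x (G x u) v)"
      using \<Phi> by (auto simp: bilinear_def intro!: linear_compose[OF linear_G, unfolded o_def])
  qed (rule adjoint_Y_d2f)
  ultimately show ?thesis
    by (simp add: trace_g_def cov0_def linear_add[OF bilinear_linear(2)[OF \<Phi>]]
      linear_0[OF bilinear_linear(1)[OF \<Phi>]] sum.distrib add.assoc)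
qed

text \<open>
  The connection is metric. In addition to the two slots treated as for the trace, the two terms
  in the derivative of \<open>K\<close> supply the connection form of the normal bundle on either side.
\<close>

lemma has_derivative_tensor_inner:
  assumes \<Phi>: "\<And>y. bilinear (\<Phi> y)" and \<Psi>: "\<And>y. bilinear (\<Psi> y)"
    and d\<Phi>: "\<And>u v. ((\<lambda>y. \<Phi> y u v) has_derivative (\<lambda>h. \<Phi>' h u v)) (at x)"
    and d\<Psi>: "\<And>u v. ((\<lambda>y. \<Psi> y u v) has_derivative (\<lambda>h. \<Psi>' h u v)) (at x)"
  shows "((\<lambda>y. tensor_inner y (\<Phi> y) (\<Psi> y)) has_derivative
    (\<lambda>h. tensor_inner x (cov x h (\<Phi> x) (\<Phi>' h)) (\<Psi> x) + tensor_inner x (\<Phi> x) (cov x h (\<Psi> x) (\<Psi>' h)))) (at x)"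
proof -
  let ?N = "\<lambda>h i. d2ft x h (df x (G x i))"
  let ?G' = "\<lambda>h i. Y x (d2f x h (G x i)) + G x (?N h i)"
  let ?\<phi> = "\<lambda>i j. \<Phi> x (G x i) (G x j)" and ?\<psi> = "\<Psi> x"
  let ?\<phi>' = "\<lambda>h i j. \<Phi>' h (G x i) (G x j) + \<Phi> x (G x i) (?G' h j) + \<Phi> x (?G' h i) (G x j)"
  let ?\<psi>' = "\<lambda>h i j. K x (d2f x h (Y x (?\<psi> i j))) + df x (G x (d2ft x h (K x (?\<psi> i j)))) + K x (\<Psi>' h i j)"
  have "((\<lambda>y. tensor_inner y (\<Phi> y) (\<Psi> y)) has_derivative (\<lambda>h. \<Sum>i\<in>Basis. \<Sum>j\<in>Basis.
      ?\<phi> i j \<bullet> ?\<psi>' h i j + ?\<phi>' h i j \<bullet> K x (?\<psi> i j))) (at x)"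
    unfolding tensor_inner_def
    by (intro has_derivative_sum has_derivative_inner
       has_derivative_bilinear_family[OF \<Phi> d\<Phi> has_derivative_G has_derivative_G]
       has_derivative_linear_family[OF linear_K has_derivative_K d\<Psi>])
  moreover have A4: "(\<Sum>j\<in>Basis. \<Phi> x (G x i) (G x (?N h j)) \<bullet> K x (?\<psi> i j)) =
      (\<Sum>j\<in>Basis. ?\<phi> i j \<bullet> K x (?\<psi> i (Y x (d2f x h j))))" for h i
  proof (rule sum_Basis_adjoint)
    show "bilinear (\<lambda>u v. \<Phi> x (G x i) (G x u) \<bullet> K x (?\<psi> i v))"
      by (intro bilinear_inner_linear bilinear_linear \<Psi> linear_compose[OF _ linear_K, unfolded o_def]
          linear_compose[OF linear_G bilinear_linear(1)[OF \<Phi>], unfolded o_def]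
          linear_compose[OF linear_G bilinear_linear(2)[OF \<Phi>], unfolded o_def])
  qed (rule adjoint_Y_d2f)
  have A5: "(\<Sum>i\<in>Basis. \<Phi> x (G x (?N h i)) (G x j) \<bullet> K x (?\<psi> i j)) =
      (\<Sum>i\<in>Basis. ?\<phi> i j \<bullet> K x (?\<psi> (Y x (d2f x h i)) j))" for h j
  proof (rule sum_Basis_adjoint)
    show "bilinear (\<lambda>u v. \<Phi> x (G x u) (G x j) \<bullet> K x (?\<psi> v j))"
      by (intro bilinear_inner_linear bilinear_linear \<Psi> linear_compose[OF _ linear_K, unfolded o_def]
          linear_compose[OF linear_G bilinear_linear(1)[OF \<Phi>], unfolded o_def]
          linear_compose[OF linear_G bilinear_linear(2)[OF \<Phi>], unfolded o_def])
  qed (rule adjoint_Y_d2f)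
  have A5': "(\<Sum>i\<in>Basis. \<Sum>j\<in>Basis. \<Phi> x (G x (?N h i)) (G x j) \<bullet> K x (?\<psi> i j)) =
      (\<Sum>i\<in>Basis. \<Sum>j\<in>Basis. ?\<phi> i j \<bullet> K x (?\<psi> (Y x (d2f x h i)) j))" for h
    by (subst sum.swap, subst A5, subst sum.swap) (rule refl)
  have A7: "a \<bullet> df x (G x (d2ft x h c)) = d2f x h (Y x a) \<bullet> c" for a h c
    by (simp add: Y_inner[symmetric] d2ft_inner inner_commute)
  have "(\<Sum>i\<in>Basis. \<Sum>j\<in>Basis. ?\<phi> i j \<bullet> ?\<psi>' h i j + ?\<phi>' h i j \<bullet> K x (?\<psi> i j)) =
    tensor_inner x (cov x h (\<Phi> x) (\<Phi>' h)) (\<Psi> x) + tensor_inner x (\<Phi> x) (cov x h (\<Psi> x) (\<Psi>' h))" for h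
    by (simp add: tensor_inner_def cov_def cov0_def operator_linear inner_add_left inner_add_right sum.distrib
        linear_add[OF bilinear_linear(1)[OF \<Phi>]] linear_add[OF bilinear_linear(2)[OF \<Phi>]] A4 A5' A7)
  ultimately show ?thesis by simp
qed

text \<open>
  The covariant derivative of the second fundamental form, by \<open>cov_d2f\<close> below. Its symmetry in all
  three arguments is the Codazzi equation.
\<close>

definition nabla_d2f where
  "nabla_d2f x u v w = d3f x u v w + d2f x u (Y x (d2f x v w)) + d2f x v (Y x (d2f x u w)) + d2f x w (Y x (d2f x u v))"

lemma nabla_d2f_commute12: "nabla_d2f x u v w = nabla_d2f x v u w"
  by (simp add: nabla_d2f_def d3f_commute12[of x u] d2f_commute[of x u v] ac_simps)

lemma nabla_d2f_commute23: "nabla_d2f x u v w = nabla_d2f x u w v"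
  by (simp add: nabla_d2f_def d3f_commute23[of x u v] d2f_commute[of x v w] ac_simps)

lemma linear_nabla_d2f: "linear (\<lambda>u. nabla_d2f x u v w)" "linear (\<lambda>v. nabla_d2f x u v w)" "linear (\<lambda>w. nabla_d2f x u v w)"
  by (auto intro!: linearI simp: nabla_d2f_def operator_linear scaleR_add_right)

lemma bilinear_nabla_d2f: "bilinear (nabla_d2f x u)"
  using linear_nabla_d2f(2,3) by (simp add: bilinear_def)

lemma cov_d2f: "cov x h (d2f x) (d3f x h) = nabla_d2f x h"
  by (intro ext) (simp add: cov_def cov0_def nabla_d2f_def d2f_commute ac_simps)

text \<open>
  The shape operator of the normal field belonging to \<open>a\<close>.
\<close>

definition shape where "shape x h a = G x (d2ft x h (K x a))"

text \<open>
  The derivative in direction \<open>h\<close> of \<open>d2f x u (Y x (d2f x v w))\<close>.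
\<close>

definition d_cubic_term where
  "d_cubic_term x h u v w = d3f x h u (Y x (d2f x v w)) +
     d2f x u (Y x (d2f x h (Y x (d2f x v w))) + shape x h (d2f x v w) + Y x (d3f x h v w))"

definition dnabla_d2f where
  "dnabla_d2f x h u v w = d4f x h u v w + d_cubic_term x h u v w + d_cubic_term x h v u w + d_cubic_term x h w u v"

lemma has_derivative_nabla_d2f: "((\<lambda>x. nabla_d2f x u v w) has_derivative (\<lambda>h. dnabla_d2f x h u v w)) (at x)"
proof -
  have "((\<lambda>x. d2f x u (Y x (d2f x v w))) has_derivative (\<lambda>h. d_cubic_term x h u v w)) (at x)" for u v w
    unfolding d_cubic_term_def shape_def
    by (intro has_derivative_linear_family linear_d2f2 has_derivative_d2f linear_Y has_derivative_Y)
  then show ?thesis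
    unfolding nabla_d2f_def dnabla_d2f_def by (intro has_derivative_add has_derivative_d3f)
qed

lemma dnabla_d2f_commute: "dnabla_d2f x h u v w = dnabla_d2f x h v u w" "dnabla_d2f x h u v w = dnabla_d2f x h u w v"
proof -
  have "((\<lambda>x. nabla_d2f x u v w) has_derivative (\<lambda>h. dnabla_d2f x h v u w)) (at x)"
    using has_derivative_nabla_d2f[of v u w x] by (simp only: nabla_d2f_commute12[of _ v u])
  from has_derivative_unique[OF has_derivative_nabla_d2f this] show "dnabla_d2f x h u v w = dnabla_d2f x h v u w"
    by (rule fun_cong)
  have "((\<lambda>x. nabla_d2f x u v w) has_derivative (\<lambda>h. dnabla_d2f x h u w v)) (at x)"
    using has_derivative_nabla_d2f[of u w v x] by (simp only: nabla_d2f_commute23[of _ u w v])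
  from has_derivative_unique[OF has_derivative_nabla_d2f this] show "dnabla_d2f x h u v w = dnabla_d2f x h u w v"
    by (rule fun_cong)
qed

text \<open>
  The covariant derivative of \<open>nabla_d2f\<close> in direction \<open>h\<close>, which is differentiated in all of its
  three slots and in the normal bundle.
\<close>

definition nabla2_d2f where
  "nabla2_d2f x h u v w = dnabla_d2f x h u v w + d2f x h (Y x (nabla_d2f x u v w)) +
     nabla_d2f x (Y x (d2f x h u)) v w + nabla_d2f x u (Y x (d2f x h v)) w + nabla_d2f x u v (Y x (d2f x h w))"

lemma nabla2_d2f_commute12: "nabla2_d2f x h u v w = nabla2_d2f x h v u w"
  unfolding nabla2_d2f_def dnabla_d2f_commute(1)[of x h u v w]
  by (simp add: nabla_d2f_commute12 nabla_d2f_commute23 ac_simps)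

lemma nabla2_d2f_commute23: "nabla2_d2f x h u v w = nabla2_d2f x h u w v"
  unfolding nabla2_d2f_def dnabla_d2f_commute(2)[of x h u v w]
  by (simp add: nabla_d2f_commute12 nabla_d2f_commute23 ac_simps)

text \<open>
  The commutator of covariant derivatives in the directions \<open>z\<close> and \<open>u\<close>, applied to the second
  fundamental form at \<open>v\<close> and \<open>w\<close>. By the Gauss and Ricci equations the curvatures of the tangent
  and the normal bundle are quadratic in the second fundamental form, through the shape operator.
\<close>

definition curv where
  "curv x z u v w = d2f x u (shape x z (d2f x v w)) - d2f x z (shape x u (d2f x v w))
     + d2f x (shape x z (d2f x u v)) w - d2f x (shape x u (d2f x z v)) w
     + d2f x v (shape x z (d2f x u w)) - d2f x v (shape x u (d2f x z w))"

text \<open>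
  The Ricci identity. After expansion all terms with third or fourth derivatives are symmetric
  in \<open>z\<close> and \<open>u\<close>, and so are those in which only \<open>Y\<close> and \<open>d2f\<close> are iterated; what remains are
  the terms through the shape operator.
\<close>

lemma nabla2_d2f_swap: "nabla2_d2f x z u v w = nabla2_d2f x u z v w + curv x z u v w"
  unfolding nabla2_d2f_def curv_def dnabla_d2f_def d_cubic_term_def nabla_d2f_def operator_linear
  by (simp add: d2f_commute d3f_commute12 d3f_commute23 d4f_commute12[of x z u] algebra_simps)

section \<open>Frames and the growth of the inverse metric\<close>

text \<open>
  The eigenvalues of \<open>I - P\<^sup>T P\<close> lie in \<open>(0,1]\<close>, so each of them is at least their product. This is
  how a bound on \<open>*\<Omega>\<close> controls the inverse metric in every direction.
\<close>

lemma gram_eigenframe: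
  obtains e :: "'m \<Rightarrow> real^'m" and l :: "'m \<Rightarrow> real"
  where "orthonormal_frame e" "\<forall>p. G x (e p) = (1 / l p) *\<^sub>R e p"
    "\<forall>p. 0 < l p \<and> det (matrix (gram x)) \<le> l p" "0 < det (matrix (gram x))"
proof -
  obtain e l where o: "orthonormal_frame e" and eig: "\<forall>p. gram x (e p) = l p *\<^sub>R e p"
    by (rule self_adjoint_orthonormal_eigenbasis[OF linear_gram[of x] gram_symmetric])
  note on = orthonormal_frame_inner[OF o] and ex = orthonormal_frame_expand[OF o]
  have l: "l p = gram x (e p) \<bullet> e p" for p by (simp add: eig on)
  have e0: "e p \<noteq> 0" for p using on[of p p] by auto
  have lpos: "0 < l p" for p unfolding l by (rule gram_pos[OF e0])
  have l1: "l p \<le> 1" for p unfolding l by (simp add: gram_inner on)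
  have det: "det (matrix (gram x)) = prod l UNIV"
    by (rule det_eq_prod_eigenvalues[OF o]) (simp add: matrix_gram eig)
  also have "prod l UNIV \<le> l p" for p
  proof -
    have "prod l UNIV = l p * prod l (UNIV - {p})" by (simp add: prod.remove)
    also have "\<dots> \<le> l p * 1"
      using lpos l1 by (intro mult_left_mono prod_le_1) (auto simp: less_imp_le)
    finally show ?thesis by simp
  qed
  finally have d: "det (matrix (gram x)) \<le> l p" for p .
  have "G x (e p) = (1 / l p) *\<^sub>R e p" for p
  proof -
    have "G x (gram x (e p)) = l p *\<^sub>R G x (e p)" by (simp only: eig linear_scale[OF linear_G])
    then have "(1 / l p) *\<^sub>R e p = (1 / l p) *\<^sub>R (l p *\<^sub>R G x (e p))" by simp
    then show ?thesis using lpos[of p] by simp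
  qed
  moreover have "0 < det (matrix (gram x))"
    unfolding det using lpos by (simp add: prod_pos)
  ultimately show ?thesis using that[OF o] lpos d by blast
qed

lemma det_gram_pos: "det (matrix (gram x)) > 0"
  by (rule gram_eigenframe[of x])

lemma frame_exists:
  obtains e where "frame x e" "\<And>p. e p \<bullet> e p \<le> 1 / det (matrix (gram x))"
proof -
  obtain u l where o: "orthonormal_frame u" and G0: "\<forall>p. G x (u p) = (1 / l p) *\<^sub>R u p"
    and l0: "\<forall>p. 0 < l p \<and> det (matrix (gram x)) \<le> l p" and "0 < det (matrix (gram x))"
    by (rule gram_eigenframe[of x])
  note on = orthonormal_frame_inner[OF o] and ex = orthonormal_frame_expand[OF o]
  have G: "G x (u p) = (1 / l p) *\<^sub>R u p" and l: "0 < l p" "det (matrix (gram x)) \<le> l p" for p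
    using G0 l0 by auto
  define e where "e p = (1 / sqrt (l p)) *\<^sub>R u p" for p
  have "G x v = (\<Sum>p\<in>UNIV. (v \<bullet> e p) *\<^sub>R e p)" for v
  proof -
    have "G x v = G x (\<Sum>p\<in>UNIV. (v \<bullet> u p) *\<^sub>R u p)" by (simp only: ex)
    also have "\<dots> = (\<Sum>p\<in>UNIV. (v \<bullet> u p) *\<^sub>R G x (u p))"
      by (simp only: linear_sum[OF linear_G] linear_scale[OF linear_G])
    also have "\<dots> = (\<Sum>p\<in>UNIV. (v \<bullet> e p) *\<^sub>R e p)"
      using l(1) by (intro sum.cong refl) (simp add: G e_def less_imp_le)
    finally show ?thesis .
  qed
  then have "frame x e" by (simp add: frame_def)
  moreover have "e p \<bullet> e p \<le> 1 / det (matrix (gram x))" for p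
  proof -
    have "e p \<bullet> e p = 1 / l p" using l(1)[of p] by (simp add: e_def on less_imp_le)
    also have "\<dots> \<le> 1 / det (matrix (gram x))"
      using det_gram_pos l by (intro divide_left_mono mult_pos_pos) auto
    finally show ?thesis .
  qed
  ultimately show ?thesis by (rule that)
qed

lemma G_norm_le: "(norm (G x v))\<^sup>2 \<le> (v \<bullet> G x v) / det (matrix (gram x))"
proof -
  obtain u l where o: "orthonormal_frame u" and G0: "\<forall>p. G x (u p) = (1 / l p) *\<^sub>R u p"
    and l0: "\<forall>p. 0 < l p \<and> det (matrix (gram x)) \<le> l p" and "0 < det (matrix (gram x))"
    by (rule gram_eigenframe[of x])
  note on = orthonormal_frame_inner[OF o] and ex = orthonormal_frame_expand[OF o]
  have G: "G x (u p) = (1 / l p) *\<^sub>R u p" and l: "0 < l p" "det (matrix (gram x)) \<le> l p" for p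
    using G0 l0 by auto
  have Gv: "G x v \<bullet> u p = (v \<bullet> u p) / l p" for p
    by (simp add: G_symmetric G)
  have expand: "a \<bullet> G x v = (\<Sum>p\<in>UNIV. (a \<bullet> u p) * (v \<bullet> u p) / l p)" for a
  proof -
    have "a \<bullet> G x v = (\<Sum>p\<in>UNIV. (a \<bullet> u p) *\<^sub>R u p) \<bullet> G x v" by (simp only: ex)
    also have "\<dots> = (\<Sum>p\<in>UNIV. (a \<bullet> u p) * (G x v \<bullet> u p))"
      by (simp only: inner_sum_left inner_scaleR_left inner_commute[of "u _" "G x v"])
    finally show ?thesis by (simp only: Gv times_divide_eq_right)
  qed
  have "(norm (G x v))\<^sup>2 = (\<Sum>p\<in>UNIV. (v \<bullet> u p)\<^sup>2 / l p * (1 / l p))"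
    unfolding power2_norm_eq_inner expand Gv by (simp add: power2_eq_square)
  also have "\<dots> \<le> (\<Sum>p\<in>UNIV. (v \<bullet> u p)\<^sup>2 / l p * (1 / det (matrix (gram x))))"
    using l det_gram_pos less_imp_le by (intro sum_mono mult_left_mono divide_left_mono mult_pos_pos) (auto simp: less_imp_le)
  also have "\<dots> = (v \<bullet> G x v) / det (matrix (gram x))"
    unfolding expand by (simp add: power2_eq_square sum_divide_distrib)
  finally show ?thesis .
qed

text \<open>
  Diagonalizing \<open>K\<close> splits a tensor with values in the normal bundle into \<open>n\<close> scalar ones.
\<close>

lemma normal_frame_exists:
  obtains l :: "'n \<Rightarrow> real^'n \<Rightarrow> real" where "\<And>a c. a \<bullet> K x c = (\<Sum>i\<in>UNIV. l i a * l i c)"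
proof -
  obtain e k where o: "orthonormal_frame e" and eig0: "\<forall>p. K x (e p) = k p *\<^sub>R e p"
    by (rule self_adjoint_orthonormal_eigenbasis[OF linear_K[of x] K_symmetric])
  note on = orthonormal_frame_inner[OF o] and ex = orthonormal_frame_expand[OF o]
  have eig: "K x (e p) = k p *\<^sub>R e p" for p using eig0 by blast
  have k: "k p \<ge> 0" for p using K_ge[where x = x and a = "e p"] by (simp add: eig on)
  have "a \<bullet> K x c = (\<Sum>p\<in>UNIV. (sqrt (k p) * (a \<bullet> e p)) * (sqrt (k p) * (c \<bullet> e p)))" for a c
  proof -
    have "K x c = K x (\<Sum>p\<in>UNIV. (c \<bullet> e p) *\<^sub>R e p)" by (simp only: ex)
    also have "\<dots> = (\<Sum>p\<in>UNIV. (c \<bullet> e p) *\<^sub>R k p *\<^sub>R e p)"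
      by (simp only: linear_sum[OF linear_K] linear_scale[OF linear_K] eig)
    finally have "a \<bullet> K x c = (\<Sum>p\<in>UNIV. (c \<bullet> e p) * (k p * (a \<bullet> e p)))"
      by (simp add: inner_sum_right mult.assoc)
    also have "\<dots> = (\<Sum>p\<in>UNIV. (sqrt (k p) * sqrt (k p)) * ((a \<bullet> e p) * (c \<bullet> e p)))"
      using k by (intro sum.cong refl) simp
    also have "\<dots> = (\<Sum>p\<in>UNIV. (sqrt (k p) * (a \<bullet> e p)) * (sqrt (k p) * (c \<bullet> e p)))"
      by (simp only: ac_simps)
    finally show ?thesis .
  qed
  then show ?thesis by (rule that)
qed

lemma K_commute: "a \<bullet> K x c = c \<bullet> K x a"
  using K_symmetric[of x a c] by (simp add: inner_commute)

lemma tensor_inner_commute: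
  assumes "bilinear \<Phi>" "bilinear \<Psi>"
  shows "tensor_inner x \<Phi> \<Psi> = tensor_inner x \<Psi> \<Phi>"
proof -
  obtain e where e: "frame x e" using frame_exists by blast
  show ?thesis
    unfolding tensor_inner_frame[OF assms e] tensor_inner_frame[OF assms(2,1) e]
    by (intro sum.cong refl K_commute)
qed

section \<open>The Simons inequality\<close>

text \<open>
  The squared norm of the second fundamental form, made nonnegative by the reversed sign of the
  normal form, with its first and second directional derivatives.
\<close>

definition sq_sff where "sq_sff x = tensor_inner x (d2f x) (d2f x)"
definition sq_sff_deriv where "sq_sff_deriv x h = 2 * tensor_inner x (nabla_d2f x h) (d2f x)"
definition sq_sff_deriv2 where "sq_sff_deriv2 x h k = 2 * (tensor_inner x (cov x h (nabla_d2f x k) (dnabla_d2f x h k)) (d2f x) + tensor_inner x (nabla_d2f x k) (nabla_d2f x h))"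

lemma has_derivative_sq_sff: "(sq_sff has_derivative sq_sff_deriv x) (at x)"
proof -
  have "((\<lambda>x. tensor_inner x (d2f x) (d2f x)) has_derivative
      (\<lambda>h. tensor_inner x (nabla_d2f x h) (d2f x) + tensor_inner x (d2f x) (nabla_d2f x h))) (at x)"
    using has_derivative_tensor_inner[OF bilinear_d2f bilinear_d2f has_derivative_d2f has_derivative_d2f]
    by (simp only: cov_d2f)
  then show ?thesis
    unfolding sq_sff_def[abs_def] sq_sff_deriv_def[abs_def] tensor_inner_commute[OF bilinear_d2f bilinear_nabla_d2f] by simp
qed

lemma has_derivative_sq_sff_deriv: "((\<lambda>x. sq_sff_deriv x k) has_derivative (\<lambda>h. sq_sff_deriv2 x h k)) (at x)"
  unfolding sq_sff_deriv_def sq_sff_deriv2_def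
  using has_derivative_tensor_inner[OF bilinear_nabla_d2f bilinear_d2f has_derivative_nabla_d2f has_derivative_d2f]
  by (intro has_derivative_mult_right) (simp only: cov_d2f)

text \<open>
  The vector \<open>m\<close> times the mean curvature vector, in the trivialization of the normal bundle; see
  \<open>mean_curvature_graph\<close> below.
\<close>

definition tau where "tau x = trace_g x (d2f x)"

text \<open>
  Traces commute with covariant derivatives, so the trace of \<open>nabla_d2f\<close> is the
  covariant derivative of \<open>tau\<close>.
\<close>

lemma trace_g_nabla_d2f:
  assumes tau0: "\<And>x. tau x = 0"
  shows "trace_g x (nabla_d2f x h) = 0"
proof -
  have "((\<lambda>x. tau x) has_derivative (\<lambda>h. trace_g x (cov0 x h (d2f x) (d3f x h)))) (at x)"
    unfolding tau_def by (rule has_derivative_trace_g[OF bilinear_d2f has_derivative_d2f])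
  moreover have "((\<lambda>x. tau x) has_derivative (\<lambda>h. 0)) (at x)" by (simp add: tau0)
  ultimately have "(\<lambda>h. trace_g x (cov0 x h (d2f x) (d3f x h))) = (\<lambda>h. 0)"
    by (rule has_derivative_unique)
  then have "trace_g x (cov0 x h (d2f x) (d3f x h)) = 0" by (rule fun_cong)
  moreover have "trace_g x (nabla_d2f x h) = trace_g x (cov0 x h (d2f x) (d3f x h)) + d2f x h (Y x (tau x))"
    unfolding cov_d2f[symmetric]
    by (simp add: trace_g_def tau_def cov_def sum.distrib linear_sum[OF linear_Y] linear_sum[OF linear_d2f2])
  ultimately show ?thesis by (simp add: tau0 operator_linear)
qed

lemma trace_g_nabla2_d2f:
  assumes tau0: "\<And>x. tau x = 0"
  shows "trace_g x (\<lambda>u v. nabla2_d2f x h w u v) = 0"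
proof -
  have "((\<lambda>x. trace_g x (nabla_d2f x w)) has_derivative (\<lambda>h. trace_g x (cov0 x h (nabla_d2f x w) (dnabla_d2f x h w)))) (at x)"
    by (rule has_derivative_trace_g[OF bilinear_nabla_d2f has_derivative_nabla_d2f])
  moreover have "((\<lambda>x. trace_g x (nabla_d2f x w)) has_derivative (\<lambda>h. 0)) (at x)" by (simp add: trace_g_nabla_d2f[OF tau0])
  ultimately have "(\<lambda>h. trace_g x (cov0 x h (nabla_d2f x w) (dnabla_d2f x h w))) = (\<lambda>h. 0)"
    by (rule has_derivative_unique)
  then have 0: "trace_g x (cov0 x h (nabla_d2f x w) (dnabla_d2f x h w)) = 0" by (rule fun_cong)
  have "trace_g x (\<lambda>u v. nabla2_d2f x h w u v) = trace_g x (cov0 x h (nabla_d2f x w) (dnabla_d2f x h w))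
      + d2f x h (Y x (trace_g x (nabla_d2f x w))) + trace_g x (nabla_d2f x (Y x (d2f x h w)))"
    by (simp add: trace_g_def nabla2_d2f_def cov0_def sum.distrib linear_sum[OF linear_Y] linear_sum[OF linear_d2f2])
  then show ?thesis by (simp add: 0 trace_g_nabla_d2f[OF tau0] operator_linear)
qed

lemma d4f_commute23: "d4f x t u v w = d4f x t v u w"
  unfolding d4f_def using dir_deriv_commute[OF smooth_map_dir_deriv[OF smooth]] by metis

lemma d4f_commute34: "d4f x t u v w = d4f x t u w v"
  unfolding d4f_def using dir_deriv_commute[OF smooth] by metis

lemma linear_d4f2: "linear (\<lambda>u. d4f x t u v w)"
  unfolding d4f_commute12[of x t] unfolding d4f_def
  by (intro linear_dir_deriv smooth_map_differentiable smooth_derivs)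

lemma linear_d4f3: "linear (\<lambda>v. d4f x t u v w)"
  unfolding d4f_commute23[of x t u] by (rule linear_d4f2)

lemma linear_d4f4: "linear (\<lambda>w. d4f x t u v w)"
  unfolding d4f_commute34[of x t u v] by (rule linear_d4f3)

lemma linear_shape: "linear (shape x h)"
  by (auto intro!: linearI simp: shape_def operator_linear)

lemma bilinear_dnabla_d2f: "bilinear (dnabla_d2f x h u)"
  unfolding bilinear_def
  by (auto intro!: linearI simp: dnabla_d2f_def d_cubic_term_def operator_linear linear_add[OF linear_shape] linear_scale[OF linear_shape]
      linear_add[OF linear_d4f3] linear_scale[OF linear_d4f3] linear_add[OF linear_d4f4] linear_scale[OF linear_d4f4]
      scaleR_add_right)

lemma bilinear_nabla2_d2f: "bilinear (nabla2_d2f x h u)"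
  unfolding bilinear_def
  by (auto intro!: linearI simp: nabla2_d2f_def operator_linear
      linear_add[OF linear_nabla_d2f(3)] linear_add[OF linear_nabla_d2f(2)] linear_add[OF linear_nabla_d2f(1)]
      linear_scale[OF linear_nabla_d2f(3)] linear_scale[OF linear_nabla_d2f(2)] linear_scale[OF linear_nabla_d2f(1)]
      linear_add[OF bilinear_linear(1)[OF bilinear_dnabla_d2f]] linear_add[OF bilinear_linear(2)[OF bilinear_dnabla_d2f]]
      linear_scale[OF bilinear_linear(1)[OF bilinear_dnabla_d2f]] linear_scale[OF bilinear_linear(2)[OF bilinear_dnabla_d2f]]
      scaleR_add_right)

lemma shape_frame:
  assumes "frame x e"
  shows "shape x h a = (\<Sum>s\<in>UNIV. (d2f x h (e s) \<bullet> K x a) *\<^sub>R e s)"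
  using assms unfolding frame_def shape_def by (simp add: d2ft_inner inner_commute)

lemma cov_nabla_d2f:
  "cov x h (nabla_d2f x h) (dnabla_d2f x h h) u v = nabla2_d2f x h h u v - nabla_d2f x (Y x (d2f x h h)) u v"
  by (simp add: cov_def cov0_def nabla2_d2f_def)

text \<open>
  The Laplacian of \<open>|b|\<^sup>2\<close> is twice \<open>|\<nabla>b|\<^sup>2 + \<langle>\<Delta>b, b\<rangle>\<close>. By the Codazzi equation and the Ricci identity,
  \<open>\<Delta>b\<close> differs from the second covariant derivative of the trace of \<open>b\<close>, which is
  zero, by \<open>curv\<close>. The resulting quartic in the components of \<open>b\<close> is that of
  \<open>simons_quartic_inequality\<close>.
\<close>

lemma laplacian_sq_sff_ge:
  assumes tau0: "\<And>x. tau x = 0" and e: "frame x e"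
  shows "(\<Sum>p\<in>UNIV. sq_sff_deriv2 x (e p) (e p)) \<ge> 2 / CARD('n) * (sq_sff x)\<^sup>2"
proof -
  define B where "B p q = d2f x (e p) (e q)" for p q
  define c where "c p q r s = B p q \<bullet> K x (B r s)" for p q r s
  obtain l where l: "\<And>a c. a \<bullet> K x c = (\<Sum>i\<in>(UNIV::'n set). l i a * l i c)"
    using normal_frame_exists[of x] by blast
  define A where "A i p q = l i (B p q)" for i p q
  have cA: "c = (\<lambda>p q r s. \<Sum>i\<in>UNIV. A i p q * A i r s)"
    by (intro ext) (simp add: c_def A_def l)
  have Bsym: "B p q = B q p" for p q by (simp add: B_def d2f_commute)
  have Sx: "sq_sff x = (\<Sum>p\<in>UNIV. \<Sum>q\<in>UNIV. c p q p q)"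
    unfolding sq_sff_def tensor_inner_frame[OF bilinear_d2f bilinear_d2f e] c_def B_def ..
  have tr0: "(\<Sum>p\<in>UNIV. d2f x (e p) (e p)) = 0"
    using trace_g_frame[OF bilinear_d2f e] tau0[of x] by (simp add: tau_def)
  define Q where "Q p q r = curv x (e p) (e q) (e p) (e r) \<bullet> K x (B q r)" for p q r
  have bil: "bilinear (cov x (e p) (nabla_d2f x (e p)) (dnabla_d2f x (e p) (e p)))" for p
  proof -
    have "cov x (e p) (nabla_d2f x (e p)) (dnabla_d2f x (e p) (e p)) =
        (\<lambda>u v. nabla2_d2f x (e p) (e p) u v - nabla_d2f x (Y x (d2f x (e p) (e p))) u v)"
      by (intro ext cov_nabla_d2f)
    then show ?thesis
      using bilinear_nabla2_d2f[of x "e p" "e p"] bilinear_nabla_d2f[of x "Y x (d2f x (e p) (e p))"]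
      by (auto simp: bilinear_def intro!: linear_compose_sub)
  qed
  have "(\<Sum>p\<in>UNIV. tensor_inner x (cov x (e p) (nabla_d2f x (e p)) (dnabla_d2f x (e p) (e p))) (d2f x)) =
    (\<Sum>p\<in>UNIV. \<Sum>q\<in>UNIV. \<Sum>r\<in>UNIV. Q p q r)"
  proof -
    have "(\<Sum>p\<in>UNIV. cov x (e p) (nabla_d2f x (e p)) (dnabla_d2f x (e p) (e p)) (e q) (e r)) =
        (\<Sum>p\<in>UNIV. curv x (e p) (e q) (e p) (e r))" for q r
    proof -
      have T: "(\<Sum>p\<in>UNIV. nabla_d2f x (Y x (d2f x (e p) (e p))) (e q) (e r)) = 0"
        by (simp add: linear_sum[OF linear_nabla_d2f(1), symmetric] linear_sum[OF linear_Y, symmetric] tr0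
            linear_0[OF linear_Y] linear_0[OF linear_nabla_d2f(1)])
      have "nabla2_d2f x (e p) (e p) (e q) (e r) = nabla2_d2f x (e q) (e r) (e p) (e p) + curv x (e p) (e q) (e p) (e r)" for p
        using nabla2_d2f_commute12[of x "e p" "e p" "e q" "e r"] nabla2_d2f_swap[of x "e p" "e q" "e p" "e r"]
          nabla2_d2f_commute23[of x "e q" "e p" "e p" "e r"] nabla2_d2f_commute12[of x "e q" "e p" "e r" "e p"] by simp
      moreover have "(\<Sum>p\<in>UNIV. nabla2_d2f x (e q) (e r) (e p) (e p)) = 0"
        using trace_g_frame[OF bilinear_nabla2_d2f[of x "e q" "e r"] e] trace_g_nabla2_d2f[OF tau0, of x "e q" "e r"] by simp
      ultimately show ?thesis by (simp add: cov_nabla_d2f sum_subtractf sum.distrib T)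
    qed
    then have eq: "(\<Sum>p\<in>UNIV. cov x (e p) (nabla_d2f x (e p)) (dnabla_d2f x (e p) (e p)) (e q) (e r) \<bullet> K x (B q r)) =
        (\<Sum>p\<in>UNIV. Q p q r)" for q r
      unfolding Q_def inner_sum_left[symmetric] by simp
    have "(\<Sum>p\<in>UNIV. tensor_inner x (cov x (e p) (nabla_d2f x (e p)) (dnabla_d2f x (e p) (e p))) (d2f x)) =
      (\<Sum>q\<in>UNIV. \<Sum>r\<in>UNIV. \<Sum>p\<in>UNIV. cov x (e p) (nabla_d2f x (e p)) (dnabla_d2f x (e p) (e p)) (e q) (e r) \<bullet> K x (B q r))"
      unfolding tensor_inner_frame[OF bil bilinear_d2f e] B_def by (rule sum_rotate3)
    also have "\<dots> = (\<Sum>q\<in>UNIV. \<Sum>r\<in>UNIV. \<Sum>p\<in>UNIV. Q p q r)" by (simp only: eq)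
    also have "\<dots> = (\<Sum>p\<in>UNIV. \<Sum>q\<in>UNIV. \<Sum>r\<in>UNIV. Q p q r)"
      by (rule sum_rotate3[symmetric])
    finally show ?thesis .
  qed
  moreover have "(\<Sum>p\<in>UNIV. \<Sum>q\<in>UNIV. \<Sum>r\<in>UNIV. Q p q r) =
    (\<Sum>p\<in>UNIV. \<Sum>q\<in>UNIV. \<Sum>r\<in>UNIV. \<Sum>s\<in>UNIV.
      c p s p r * c q s q r - 2 * (c q s p r * c p s q r) + c p s q p * c s r q r + (c p s q r)\<^sup>2)"
  proof -
    define Z where "Z p q r = d2f x (shape x (e q) (B p p)) (e r) \<bullet> K x (B q r)" for p q r
    have Nf: "shape x (e p) a = (\<Sum>s\<in>UNIV. (B p s \<bullet> K x a) *\<^sub>R e s)" for p a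
      unfolding B_def by (rule shape_frame[OF e])
    \<comment> \<open>Expand the shape operator in the frame; \<open>Z\<close> is the one term of \<open>curv\<close> that contains \<open>\<tau>\<close>.\<close>
    have dl: "d2f x (shape x (e p) a) (e r) = (\<Sum>s\<in>UNIV. (B p s \<bullet> K x a) *\<^sub>R B s r)" for p a r
      unfolding Nf linear_sum[OF linear_d2f1] linear_scale[OF linear_d2f1] B_def ..
    have dr: "d2f x (e r) (shape x (e p) a) = (\<Sum>s\<in>UNIV. (B p s \<bullet> K x a) *\<^sub>R B r s)" for p a r
      unfolding Nf linear_sum[OF linear_d2f2] linear_scale[OF linear_d2f2] B_def ..
    have "Q p q r = (\<Sum>s\<in>UNIV. c p s p r * c q s q r - 2 * (c q s p r * c p s q r)
        + c p s q p * c s r q r + (c p s q r)\<^sup>2) - Z p q r" for p q r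
      unfolding Q_def curv_def Z_def B_def[symmetric] dr dl
      unfolding inner_diff_left inner_add_left inner_sum_left inner_scaleR_left c_def[symmetric]
      by (simp add: sum.distrib sum_subtractf sum_negf sum_distrib_left power2_eq_square)
    moreover have "(\<Sum>p\<in>UNIV. \<Sum>q\<in>UNIV. \<Sum>r\<in>UNIV. Z p q r) = 0"
    proof -
      have "(\<Sum>p\<in>UNIV. Z p q r) = 0" for q r
        unfolding Z_def inner_sum_left[symmetric] linear_sum[OF linear_d2f1, symmetric] linear_sum[OF linear_shape, symmetric]
        by (simp add: B_def tr0 linear_0[OF linear_shape] linear_0[OF linear_d2f1])
      moreover have "(\<Sum>p\<in>UNIV. \<Sum>q\<in>UNIV. \<Sum>r\<in>UNIV. Z p q r) =
         (\<Sum>q\<in>UNIV. \<Sum>r\<in>UNIV. \<Sum>p\<in>UNIV. Z p q r)"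
        by (rule sum_rotate3)
      ultimately show ?thesis by simp
    qed
    ultimately show ?thesis by (simp add: sum_subtractf)
  qed
  moreover have "\<dots> \<ge> (sq_sff x)\<^sup>2 / CARD('n)"
    unfolding Sx cA by (rule simons_quartic_inequality) (simp add: A_def Bsym)
  moreover have "tensor_inner x (nabla_d2f x (e p)) (nabla_d2f x (e p)) \<ge> 0" for p
    unfolding tensor_inner_frame[OF bilinear_nabla_d2f bilinear_nabla_d2f e]
    using K_ge by (intro sum_nonneg) (metis K_commute inner_commute inner_ge_zero order_trans)
  then have "(\<Sum>p\<in>UNIV. tensor_inner x (nabla_d2f x (e p)) (nabla_d2f x (e p))) \<ge> 0" by (rule sum_nonneg)
  ultimately show ?thesis
    unfolding sq_sff_deriv2_def sum_distrib_left[symmetric] sum.distrib by simp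
qed

section \<open>The interior estimate for maximal graphs\<close>

text \<open>
  The square of \<open>*\<Omega>\<close>; see \<open>star_Omega_squared\<close> below.
\<close>

definition Omega_sq where "Omega_sq x = 1 / det (matrix (gram x))"

lemma sq_sff_nonneg: "sq_sff x \<ge> 0"
proof -
  obtain e where e: "frame x e" using frame_exists by blast
  show ?thesis
    unfolding sq_sff_def tensor_inner_frame[OF bilinear_d2f bilinear_d2f e]
  proof (intro sum_nonneg)
    fix p q
    show "0 \<le> d2f x (e p) (e q) \<bullet> K x (d2f x (e p) (e q))"
      using K_ge[of "d2f x (e p) (e q)" x] inner_ge_zero[of "d2f x (e p) (e q)"]
      unfolding K_symmetric by linarith
  qed
qed

text \<open>
  Maximum principle for \<open>|b|\<^sup>2 r\<^sup>2\<close> with \<open>r = R\<^sup>2 - |x - c|\<^sup>2\<close>. At an interior maximum the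
  gradient of \<open>|b|\<^sup>2\<close> is determined by that of \<open>r\<close>, and summing the second derivatives along a frame
  \<open>e\<close> gives \<open>r\<^sup>2 \<Delta>|b|\<^sup>2 \<le> 28 R\<^sup>2 |b|\<^sup>2 \<Sum>|e\<^sub>p|\<^sup>2\<close>. The Simons inequality bounds the left-hand side from
  below by a multiple of \<open>|b|\<^sup>4 r\<^sup>2\<close>, and every \<open>|e\<^sub>p|\<^sup>2\<close> is at most \<open>(*\<Omega>)\<^sup>2\<close>.
\<close>

lemma interior_estimate_sq_sff:
  fixes R M :: real
  assumes tau0: "\<And>x. tau x = 0" and R: "R > 0"
    and WM: "\<And>x. x \<in> cball c R \<Longrightarrow> Omega_sq x \<le> M"
  shows "sq_sff c * R\<^sup>2 \<le> 14 * CARD('n) * CARD('m) * M"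
proof -
  define r where "r x = R\<^sup>2 - (x - c) \<bullet> (x - c)" for x
  have contS: "continuous_on UNIV sq_sff"
    by (simp add: continuous_on_eq_continuous_at has_derivative_continuous[OF has_derivative_sq_sff])
  have "continuous_on (cball c R) (\<lambda>x. sq_sff x * (r x)\<^sup>2)"
    unfolding r_def by (intro continuous_intros continuous_on_subset[OF contS]) auto
  moreover have "cball c R \<noteq> {}" using R by simp
  ultimately have "\<exists>x\<in>cball c R. \<forall>y\<in>cball c R. sq_sff y * (r y)\<^sup>2 \<le> sq_sff x * (r x)\<^sup>2"
    by (intro continuous_attains_sup compact_cball)
  then obtain x where x: "x \<in> cball c R"
    and mx: "\<And>y. y \<in> cball c R \<Longrightarrow> sq_sff y * (r y)\<^sup>2 \<le> sq_sff x * (r x)\<^sup>2"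
    by blast
  have M0: "M > 0"
  proof -
    have "0 < Omega_sq c" using det_gram_pos[of c] by (simp add: Omega_sq_def)
    also have "Omega_sq c \<le> M" using WM[of c] R by simp
    finally show ?thesis .
  qed
  have Sc: "sq_sff c * R^4 \<le> sq_sff x * (r x)\<^sup>2"
    using mx[of c] R by (simp add: r_def power_mult[symmetric])
  have rest: "sq_sff x * (r x)\<^sup>2 \<le> 14 * CARD('n) * CARD('m) * M * R\<^sup>2"
  proof (cases "sq_sff x * (r x)\<^sup>2 = 0")
    case True
    then show ?thesis unfolding True using M0 by simp
  next
    case False
    then have Sx: "sq_sff x > 0" and rx: "r x \<noteq> 0" using sq_sff_nonneg[of x] by (auto simp: less_le)
    have nx: "(x - c) \<bullet> (x - c) \<le> R\<^sup>2"
    proof -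
      have "norm (x - c) \<le> R" using x by (simp add: dist_norm norm_minus_commute)
      then have "(norm (x - c))\<^sup>2 \<le> R\<^sup>2" by (intro power_mono) auto
      then show ?thesis by (simp add: power2_norm_eq_inner)
    qed
    then have rpos: "r x > 0" and rR: "r x \<le> R\<^sup>2" using rx by (auto simp: r_def)
    have "norm (x - c) < R"
      using rpos R by (simp add: r_def norm_eq_sqrt_inner real_less_lsqrt)
    \<comment> \<open>The maximum is attained in the interior, so it may be tested along short segments.\<close>
    define \<epsilon> where "\<epsilon> = R - norm (x - c)"
    have \<epsilon>: "\<epsilon> > 0" "norm (x - c) + \<epsilon> \<le> R"
      using \<open>norm (x - c) < R\<close> by (simp_all add: \<epsilon>_def)
    obtain e where e: "frame x e" and eW: "\<And>p. e p \<bullet> e p \<le> 1 / det (matrix (gram x))"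
      using frame_exists by blast
    have key: "sq_sff_deriv2 x v v * (r x)\<^sup>2 \<le> 28 * sq_sff x * R\<^sup>2 * (v \<bullet> v)" for v
    proof (cases "v = 0")
      case True
      have "linear (\<lambda>h. sq_sff_deriv2 x h 0)" using has_derivative_linear[OF has_derivative_sq_sff_deriv] .
      then show ?thesis using True linear_0 by fastforce
    next
      case False
      define y where "y t = x + t *\<^sub>R v" for t :: real
      define r' where "r' t = - 2 * ((y t - c) \<bullet> v)" for t
      have y0: "y 0 = x" by (simp add: y_def)
      have dy: "(y has_derivative (\<lambda>s. s *\<^sub>R v)) (at t)" for t
        unfolding y_def by (auto intro!: derivative_eq_intros)
      have dr: "((\<lambda>t. r (y t)) has_real_derivative r' t) (at t)" for t
      proof -
        have "((\<lambda>t. r (y t)) has_derivative (\<lambda>s. - ((y t - c) \<bullet> (s *\<^sub>R v) + (s *\<^sub>R v) \<bullet> (y t - c)))) (at t)"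
          unfolding r_def by (auto intro!: derivative_eq_intros dy)
        moreover have "(\<lambda>s. - ((y t - c) \<bullet> (s *\<^sub>R v) + (s *\<^sub>R v) \<bullet> (y t - c))) = (*) (r' t)"
          by (auto simp: fun_eq_iff r'_def inner_commute algebra_simps)
        ultimately show ?thesis unfolding has_field_derivative_def by simp
      qed
      have dr': "(r' has_real_derivative (- 2 * (v \<bullet> v))) (at t)" for t
      proof -
        have "(r' has_derivative (\<lambda>s. - 2 * ((s *\<^sub>R v) \<bullet> v))) (at t)"
          unfolding r'_def by (auto intro!: derivative_eq_intros dy)
        moreover have "(\<lambda>s. - 2 * ((s *\<^sub>R v) \<bullet> v)) = (*) (- 2 * (v \<bullet> v))"
          by (simp add: fun_eq_iff)
        ultimately show ?thesis unfolding has_field_derivative_def by (simp only:)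
      qed
      have dS: "((\<lambda>t. sq_sff (y t)) has_real_derivative sq_sff_deriv (y t) v) (at t)" for t
      proof -
        have "((\<lambda>t. sq_sff (y t)) has_derivative (\<lambda>s. sq_sff_deriv (y t) (s *\<^sub>R v))) (at t)"
          by (rule has_derivative_compose[OF dy has_derivative_sq_sff])
        then show ?thesis unfolding has_field_derivative_def
          by (simp add: linear_scale[OF has_derivative_linear[OF has_derivative_sq_sff]] mult_commute_abs)
      qed
      have dS1: "((\<lambda>t. sq_sff_deriv (y t) v) has_real_derivative sq_sff_deriv2 x v v) (at 0)"
      proof -
        have "((\<lambda>t. sq_sff_deriv (y t) v) has_derivative (\<lambda>s. sq_sff_deriv2 (y 0) (s *\<^sub>R v) v)) (at 0)"
          by (rule has_derivative_compose[OF dy has_derivative_sq_sff_deriv])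
        then show ?thesis unfolding has_field_derivative_def
          by (simp add: y0 linear_scale[OF has_derivative_linear[OF has_derivative_sq_sff_deriv]] mult_commute_abs)
      qed
      define \<phi>1 where "\<phi>1 t = sq_sff_deriv (y t) v * (r (y t))\<^sup>2 + sq_sff (y t) * (2 * r (y t) * r' t)" for t
      have d1: "((\<lambda>t. sq_sff (y t) * (r (y t))\<^sup>2) has_real_derivative \<phi>1 t) (at t)" for t
        unfolding \<phi>1_def by (auto intro!: derivative_eq_intros dS dr simp: algebra_simps)
      have d2: "(\<phi>1 has_real_derivative (sq_sff_deriv2 x v v * (r x)\<^sup>2 + 4 * sq_sff_deriv x v * r x * r' 0
          + sq_sff x * (2 * (r' 0)\<^sup>2 - 4 * r x * (v \<bullet> v)))) (at 0)"
        unfolding \<phi>1_def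
        by (auto intro!: derivative_eq_intros dS1 dS dr dr' simp: y0 algebra_simps power2_eq_square)
      have "sq_sff (y t) * (r (y t))\<^sup>2 \<le> sq_sff (y 0) * (r (y 0))\<^sup>2" if t: "\<bar>t\<bar> < \<epsilon> / norm v" for t
      proof -
        have "norm (y t - c) \<le> norm (x - c) + \<bar>t\<bar> * norm v"
          using norm_triangle_ineq[of "x - c" "t *\<^sub>R v"] by (simp add: y_def algebra_simps)
        also have "\<dots> \<le> R" using t \<epsilon>(2) False by (simp add: field_simps)
        finally have "y t \<in> cball c R" by (simp add: dist_norm norm_minus_commute)
        then show ?thesis using mx y0 by simp
      qed
      note max = second_derivative_at_maximum[OF d1 d2, of "\<epsilon> / norm v", OF _ this]
      have z: "\<phi>1 0 = 0" and le: "sq_sff_deriv2 x v v * (r x)\<^sup>2 + 4 * sq_sff_deriv x v * r x * r' 0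
          + sq_sff x * (2 * (r' 0)\<^sup>2 - 4 * r x * (v \<bullet> v)) \<le> 0"
        using \<epsilon>(1) False by (auto intro!: max)
      \<comment> \<open>Criticality eliminates the gradient of \<open>sq_sff\<close>: the cross term becomes \<open>- 8 |b|\<^sup>2 r'\<^sup>2\<close>.\<close>
      have "r x * (sq_sff_deriv x v * r x + 2 * sq_sff x * r' 0) = 0"
        using z by (simp add: \<phi>1_def y0 algebra_simps power2_eq_square)
      then have crit: "sq_sff_deriv x v * r x = - 2 * sq_sff x * r' 0" using rx by simp
      have crit2: "4 * sq_sff_deriv x v * r x * r' 0 = - 8 * (sq_sff x * (r' 0)\<^sup>2)"
      proof -
        have "4 * sq_sff_deriv x v * r x * r' 0 = 4 * (sq_sff_deriv x v * r x) * r' 0" by (simp only: mult.assoc)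
        also have "\<dots> = 4 * (- 2 * sq_sff x * r' 0) * r' 0" by (simp only: crit)
        finally show ?thesis by (simp add: power2_eq_square)
      qed
      have a: "sq_sff_deriv2 x v v * (r x)\<^sup>2 \<le> sq_sff x * (6 * (r' 0)\<^sup>2 + 4 * r x * (v \<bullet> v))"
      proof -
        have "sq_sff x * (2 * (r' 0)\<^sup>2 - 4 * r x * (v \<bullet> v)) = 2 * (sq_sff x * (r' 0)\<^sup>2) - 4 * (sq_sff x * r x * (v \<bullet> v))"
          "sq_sff x * (6 * (r' 0)\<^sup>2 + 4 * r x * (v \<bullet> v)) = 6 * (sq_sff x * (r' 0)\<^sup>2) + 4 * (sq_sff x * r x * (v \<bullet> v))"
          by (simp_all add: algebra_simps)
        with le crit2 show ?thesis by linarith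
      qed
      have "(r' 0)\<^sup>2 = 4 * ((x - c) \<bullet> v)\<^sup>2" by (simp add: r'_def y0 power2_eq_square)
      also have "\<dots> \<le> 4 * (((x - c) \<bullet> (x - c)) * (v \<bullet> v))"
        using Cauchy_Schwarz_ineq[of "x - c" v] by simp
      also have "\<dots> \<le> 4 * (R\<^sup>2 * (v \<bullet> v))" using nx by (simp add: mult_right_mono)
      finally have b: "6 * (r' 0)\<^sup>2 + 4 * r x * (v \<bullet> v) \<le> 28 * R\<^sup>2 * (v \<bullet> v)"
        using mult_right_mono[OF rR, of "v \<bullet> v"] by simp
      have "sq_sff x * (6 * (r' 0)\<^sup>2 + 4 * r x * (v \<bullet> v)) \<le> sq_sff x * (28 * R\<^sup>2 * (v \<bullet> v))"
        using Sx by (intro mult_left_mono[OF b]) simp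
      also have "\<dots> = 28 * sq_sff x * R\<^sup>2 * (v \<bullet> v)" by simp
      finally show ?thesis using a by (rule order_trans[rotated])
    qed
    have "2 / CARD('n) * (sq_sff x)\<^sup>2 * (r x)\<^sup>2 \<le> (\<Sum>p\<in>UNIV. sq_sff_deriv2 x (e p) (e p)) * (r x)\<^sup>2"
      by (intro mult_right_mono laplacian_sq_sff_ge tau0 e) simp
    also have "\<dots> \<le> (\<Sum>p\<in>UNIV. 28 * sq_sff x * R\<^sup>2 * (e p \<bullet> e p))"
      unfolding sum_distrib_right by (intro sum_mono key)
    also have "\<dots> \<le> (\<Sum>p\<in>(UNIV::'m set). 28 * sq_sff x * R\<^sup>2 * M)"
    proof (intro sum_mono mult_left_mono)
      show "e p \<bullet> e p \<le> M" for p using eW[of p] WM[OF x] by (simp add: Omega_sq_def)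
    qed (use Sx in simp)
    finally have "sq_sff x * (2 * sq_sff x * (r x)\<^sup>2) \<le> sq_sff x * (28 * CARD('n) * CARD('m) * M * R\<^sup>2)"
      by (simp add: field_simps power2_eq_square)
    then show ?thesis using Sx by (simp add: mult_le_cancel_left_pos ac_simps)
  qed
  have "R\<^sup>2 * (sq_sff c * R\<^sup>2) \<le> R\<^sup>2 * (14 * CARD('n) * CARD('m) * M)"
    using Sc rest by (simp add: ac_simps power4_eq_xxxx power2_eq_square)
  then show ?thesis using R by (simp add: mult_le_cancel_left_pos)
qed

section \<open>Parallel mean curvature of a graph\<close>

lemma differentiable_graph: "graph_param f differentiable (at x)"
proof -
  have "((\<lambda>x. (x, f x)) has_derivative (\<lambda>h. (h, df x h))) (at x)"
    unfolding df_def
    by (intro has_derivative_Pair has_derivative_ident dir_deriv_has_derivative smooth_map_differentiable smooth)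
  then show ?thesis unfolding graph_param_def[abs_def] by (rule differentiableI)
qed

lemma tangent_space_graph: "tangent_space (graph_param f) x = range (\<lambda>u. (u, df x u))"
  by (simp add: tangent_space_def dir_deriv_graph)

lemma normal_component_graph: "normal_component (graph_param f) x (0, a) = (Y x a, K x a)"
proof -
  have "(Y x a, K x a) \<in> normal_space (graph_param f) x"
  proof -
    have "Y x a \<bullet> u = K x a \<bullet> df x u" for u using dft_inner(1)[of x "K x a" u] by (simp add: dft_K)
    then show ?thesis by (auto simp: normal_space_def tangent_space_graph pinner_def)
  qed
  moreover have "(0, a) - (Y x a, K x a) = (- Y x a, df x (- Y x a))"
    by (simp add: K_def operator_linear)
  then have "(0, a) - (Y x a, K x a) \<in> tangent_space (graph_param f) x"
    unfolding tangent_space_graph by simp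
  ultimately show ?thesis
    unfolding normal_component_def
    by (intro the1_equality normal_component_ex1 differentiable_graph spacelike) simp
qed

lemma second_fundamental_form_graph:
  "second_fundamental_form (graph_param f) x u v = (Y x (d2f x u v), K x (d2f x u v))"
proof -
  have "dir_deriv v (graph_param f) = (\<lambda>x. (v, df x v))" by (rule ext) (rule dir_deriv_graph)
  moreover have "((\<lambda>x. (v, df x v)) has_derivative (\<lambda>h. (0, d2f x h v))) (at x)"
    by (intro has_derivative_Pair has_derivative_const has_derivative_df)
  ultimately have "dir_deriv u (dir_deriv v (graph_param f)) x = (0, d2f x u v)"
    using dir_deriv_eqI by simp
  then show ?thesis by (simp add: second_fundamental_form_def normal_component_graph)
qed

lemma metric_matrix_graph: "metric_matrix (graph_param f) x = matrix (gram x)"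
proof -
  have "gram x (axis i 1) \<bullet> axis j 1 = gram x (axis j 1) $ i" for i j
    by (simp add: gram_symmetric inner_axis' )
  then show ?thesis by (simp add: metric_matrix_def induced_metric_gram vec_eq_iff matrix_gram_entry)
qed

lemma matrix_inv_metric: "matrix_inv (metric_matrix (graph_param f) x) $ i $ j = G x (axis j 1) $ i"
proof -
  let ?A = "matrix (gram x)"
  have "\<exists>B. ?A ** B = mat 1 \<and> B ** ?A = mat 1"
    using det_gram_nonzero[of x] by (simp add: invertible_det_nz[symmetric] invertible_def)
  from someI_ex[OF this] have "matrix_inv ?A ** ?A = mat 1"
    unfolding matrix_inv_def by blast
  then have "matrix_inv ?A *v (?A *v G x v) = G x v" for v
    by (simp add: matrix_vector_mul_assoc)
  then have "matrix_inv ?A *v v = G x v" for v by (simp add: matrix_gram)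
  then have "column j (matrix_inv ?A) = G x (axis j 1)"
    using matrix_vector_mult_basis[of "matrix_inv ?A" j] by simp
  then show ?thesis
    unfolding metric_matrix_graph by (simp add: column_def vec_eq_iff)
qed

lemma mean_curvature_graph:
  "mean_curvature (graph_param f) x = (1 / CARD('m)) *\<^sub>R (Y x (tau x), K x (tau x))"
proof -
  have "d2f x (G x (axis j 1)) (axis j 1) = (\<Sum>i\<in>UNIV. G x (axis j 1) $ i *\<^sub>R d2f x (axis i 1) (axis j 1))" for j
    using linear_expand_Basis[OF linear_d2f1, of x "G x (axis j 1)" "axis j 1"]
    by (simp add: sum_Basis_axis inner_axis)
  then have "tau x = (\<Sum>j\<in>UNIV. \<Sum>i\<in>UNIV. G x (axis j 1) $ i *\<^sub>R d2f x (axis i 1) (axis j 1))"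
    unfolding tau_def trace_g_def sum_Basis_axis by simp
  also have "\<dots> = (\<Sum>i\<in>UNIV. \<Sum>j\<in>UNIV. G x (axis j 1) $ i *\<^sub>R d2f x (axis i 1) (axis j 1))"
    by (rule sum.swap)
  finally have t: "tau x = (\<Sum>i\<in>UNIV. \<Sum>j\<in>UNIV. G x (axis j 1) $ i *\<^sub>R d2f x (axis i 1) (axis j 1))" .
  have "(\<Sum>i\<in>UNIV. \<Sum>j\<in>UNIV. G x (axis j 1) $ i *\<^sub>R (Y x (d2f x (axis i 1) (axis j 1)), K x (d2f x (axis i 1) (axis j 1))))
     = (Y x (tau x), K x (tau x))"
    unfolding t linear_sum[OF linear_Y] linear_sum[OF linear_K] linear_scale[OF linear_Y] linear_scale[OF linear_K]
    by (simp add: prod_eq_iff fst_sum snd_sum)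
  then show ?thesis
    unfolding mean_curvature_def second_fundamental_form_graph matrix_inv_metric by simp
qed

definition tau' where "tau' x h = trace_g x (cov0 x h (d2f x) (d3f x h))"

lemma has_derivative_tau: "(tau has_derivative tau' x) (at x)"
  using has_derivative_trace_g[OF bilinear_d2f has_derivative_d2f]
  unfolding tau_def[abs_def] tau'_def[abs_def] .

lemma has_derivative_Y_tau:
  "((\<lambda>x. Y x (tau x)) has_derivative (\<lambda>h. shape x h (tau x) + Y x (d2f x h (Y x (tau x)) + tau' x h))) (at x)"
  using has_derivative_linear_family[OF linear_Y has_derivative_Y has_derivative_tau]
  by (simp add: shape_def operator_linear ac_simps)

lemma has_derivative_K_tau:
  "((\<lambda>x. K x (tau x)) has_derivative
     (\<lambda>h. df x (shape x h (tau x)) + K x (d2f x h (Y x (tau x)) + tau' x h))) (at x)"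
  using has_derivative_linear_family[OF linear_K has_derivative_K has_derivative_tau]
  by (simp add: shape_def operator_linear ac_simps)

text \<open>
  Parallel mean curvature means that the derivative of \<open>(Y \<tau>, K \<tau>)\<close> is tangent to the graph. Its
  normal part is the normal vector that belongs to \<open>tau' x h + d2f x h (Y x (tau x))\<close>, so this
  covariant derivative of \<open>\<tau>\<close> vanishes.
\<close>

lemma parallel_tau:
  assumes par: "parallel_mean_curvature (graph_param f)"
  shows "tau' x h = - d2f x h (Y x (tau x))"
proof -
  let ?F = "graph_param f"
  let ?a = "d2f x h (Y x (tau x)) + tau' x h"
  let ?y = "shape x h (tau x) + Y x ?a" and ?k = "df x (shape x h (tau x)) + K x ?a"
  let ?w = "dir_deriv h (mean_curvature ?F) x"
  have "mean_curvature ?F = (\<lambda>x. (1 / CARD('m)) *\<^sub>R (Y x (tau x), K x (tau x)))"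
    by (rule ext) (rule mean_curvature_graph)
  moreover have "((\<lambda>x. (1 / CARD('m)) *\<^sub>R (Y x (tau x), K x (tau x))) has_derivative
      (\<lambda>h. (1 / CARD('m)) *\<^sub>R (shape x h (tau x) + Y x (d2f x h (Y x (tau x)) + tau' x h),
        df x (shape x h (tau x)) + K x (d2f x h (Y x (tau x)) + tau' x h)))) (at x)"
    by (intro has_derivative_scaleR_right has_derivative_Pair has_derivative_Y_tau has_derivative_K_tau)
  ultimately have w: "?w = (1 / CARD('m)) *\<^sub>R (?y, ?k)"
    using dir_deriv_eqI by simp
  have "normal_component ?F x ?w = 0"
    using par by (simp add: parallel_mean_curvature_def normal_connection_def)
  then have "?w - 0 \<in> tangent_space ?F x"
    using theI'[OF normal_component_ex1[OF differentiable_graph spacelike, of x ?w]]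
    unfolding normal_component_def by simp
  then obtain u where u: "?w = (u, df x u)" unfolding tangent_space_graph by auto
  have "(u, df x u) = ((1 / CARD('m)) *\<^sub>R ?y, (1 / CARD('m)) *\<^sub>R ?k)"
    using u w by simp
  then have "u = (1 / CARD('m)) *\<^sub>R ?y \<and> df x u = (1 / CARD('m)) *\<^sub>R ?k"
    unfolding prod.inject .
  note 1 = conjunct1[OF this] conjunct2[OF this]
  have "?k = CARD('m) *\<^sub>R df x u" unfolding 1(2) by simp
  also have "\<dots> = df x (CARD('m) *\<^sub>R u)" by (simp only: linear_scale[OF linear_df])
  also have "CARD('m) *\<^sub>R u = ?y" unfolding 1(1) by simp
  finally have "?k = df x ?y" .
  then have "K x ?a = df x (Y x ?a)" by (simp add: operator_linear)
  then have "?a = 0" by (simp add: K_def)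
  then show ?thesis by (simp add: eq_neg_iff_add_eq_0 add.commute)
qed

text \<open>
  The squared length of \<open>m\<close> times the mean curvature vector, with reversed sign. It is constant
  when the mean curvature is parallel, because the normal connection is metric.
\<close>

definition sq_tau where "sq_tau x = tau x \<bullet> K x (tau x)"

lemma sq_tau_nonneg: "sq_tau x \<ge> 0"
  using K_ge[of "tau x" x] inner_ge_zero[of "tau x"] unfolding sq_tau_def K_symmetric by linarith

lemma sq_tau_constant:
  assumes par: "parallel_mean_curvature (graph_param f)"
  obtains k where "\<And>x. sq_tau x = k"
proof -
  have "(sq_tau has_derivative (\<lambda>h. 0)) (at x)" for x
  proof -
    have "(sq_tau has_derivative (\<lambda>h. tau x \<bullet> (df x (shape x h (tau x)) + K x (d2f x h (Y x (tau x)) + tau' x h))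
        + tau' x h \<bullet> K x (tau x))) (at x)"
      unfolding sq_tau_def[abs_def] by (intro has_derivative_inner has_derivative_tau has_derivative_K_tau)
    moreover have "tau x \<bullet> (df x (shape x h (tau x)) + K x (d2f x h (Y x (tau x)) + tau' x h))
        + tau' x h \<bullet> K x (tau x) = 0" for h
      by (simp add: parallel_tau[OF par] operator_linear shape_def Y_inner[symmetric] d2ft_inner inner_commute)
    ultimately show ?thesis by simp
  qed
  then have "\<exists>k. \<forall>x. sq_tau x = k"
    using has_derivative_zero_constant[of UNIV sq_tau] by auto
  then show ?thesis using that by blast
qed

text \<open>
  For parallel mean curvature \<open>h \<mapsto> shape x h (tau x)\<close> is the differential of \<open>Y \<tau>\<close>, so this is the
  Euclidean divergence of the spatial part of \<open>m\<close> times the mean curvature vector: the trace of the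
  shape operator of a normal vector is its product with the trace of the second fundamental form.
\<close>

lemma divergence_Y_tau: "(\<Sum>i\<in>Basis. shape x i (tau x) \<bullet> i) = sq_tau x"
proof -
  have "(\<Sum>i\<in>Basis. shape x i (tau x) \<bullet> i) = (\<Sum>i\<in>Basis. K x (tau x) \<bullet> d2f x (G x i) i)"
    by (intro sum.cong refl) (simp add: shape_def G_symmetric d2ft_inner d2f_commute)
  also have "\<dots> = K x (tau x) \<bullet> tau x"
    by (simp add: tau_def[of x] trace_g_def inner_sum_right)
  finally show ?thesis by (simp add: sq_tau_def inner_commute)
qed

lemma norm_Y_tau_le: "(norm (Y x (tau x)))\<^sup>2 \<le> sq_tau x * Omega_sq x"
proof -
  have "(norm (Y x (tau x)))\<^sup>2 \<le> (dft x (tau x) \<bullet> G x (dft x (tau x))) * Omega_sq x"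
    using G_norm_le[of x "dft x (tau x)"] by (simp add: Y_def Omega_sq_def)
  also have "\<dots> \<le> sq_tau x * Omega_sq x"
  proof (rule mult_right_mono)
    show "dft x (tau x) \<bullet> G x (dft x (tau x)) \<le> sq_tau x"
      unfolding sq_tau_def K_symmetric[symmetric] K_inner G_symmetric by simp
    show "0 \<le> Omega_sq x" using det_gram_pos[of x] by (simp add: Omega_sq_def)
  qed
  finally show ?thesis .
qed

lemma continuous_shape_tau: "continuous_on UNIV (\<lambda>x. shape x i (tau x))"
proof -
  have d2: "((\<lambda>y. d2ft y i a) has_derivative (\<lambda>h. \<Sum>j\<in>Basis. (a \<bullet> d3f x h i j) *\<^sub>R j)) (at x)" for a x
  proof -
    have "d2ft y i a = (\<Sum>j\<in>Basis. (a \<bullet> d2f y i j) *\<^sub>R j)" for y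
      using euclidean_representation[of "d2ft y i a"] by (simp only: d2ft_inner)
    then show ?thesis
      by (simp only:) (intro has_derivative_sum has_derivative_scaleR_left has_derivative_inner_right has_derivative_d2f)
  qed
  have "continuous (at x) (\<lambda>y. shape y i (tau y))" for x
  proof -
    let ?K' = "\<lambda>h. df x (shape x h (tau x)) + K x (d2f x h (Y x (tau x)) + tau' x h)"
    have "((\<lambda>y. d2ft y i (K y (tau y))) has_derivative
        (\<lambda>h. (\<Sum>j\<in>Basis. (K x (tau x) \<bullet> d3f x h i j) *\<^sub>R j) + d2ft x i (?K' h))) (at x)"
      by (rule has_derivative_linear_family[where B = "\<lambda>y. d2ft y i"
          and B' = "\<lambda>h a. \<Sum>j\<in>Basis. (a \<bullet> d3f x h i j) *\<^sub>R j", OF linear_d2ft d2 has_derivative_K_tau])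
    from has_derivative_linear_family[OF linear_G has_derivative_G this]
    show ?thesis unfolding shape_def by (rule has_derivative_continuous)
  qed
  then show ?thesis by (simp add: continuous_on_eq_continuous_at)
qed

end

section \<open>Controlled growth\<close>

text \<open>
  Both uses of the growth hypothesis go through \<open>Omega_sq_growth\<close> below, which is uniform on balls
  about an arbitrary centre.
\<close>

locale controlled_spacelike_graph = spacelike_graph f for f :: "real^'m \<Rightarrow> real^'n" +
  assumes growth: "star_Omega f \<in> o[at_infinity](\<lambda>x. norm x)"
begin

lemma star_Omega_squared: "(star_Omega f x)\<^sup>2 = Omega_sq x"
proof -
  have "(star_Omega f x)\<^sup>2 = inverse ((sqrt (det (matrix (gram x))))\<^sup>2)"
    unfolding star_Omega_eq[OF smooth_map_differentiable[OF smooth]] metric_matrix_graph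
    by (rule power_inverse)
  then show ?thesis using det_gram_pos[of x] by (simp add: Omega_sq_def inverse_eq_divide)
qed

lemma Omega_sq_growth:
  assumes "\<epsilon> > 0"
  shows "\<forall>\<^sub>F R in at_top. \<forall>x\<in>cball c R. Omega_sq x \<le> \<epsilon> * R\<^sup>2"
proof -
  \<comment> \<open>For \<open>R \<ge> |c|\<close> the ball lies within distance \<open>2 R\<close> of the origin, whence the factor 2.\<close>
  define \<delta> where "\<delta> = sqrt \<epsilon> / 2"
  have \<delta>: "\<delta> > 0" "4 * \<delta>\<^sup>2 = \<epsilon>" using assms by (auto simp: \<delta>_def power_divide)
  have "\<forall>\<^sub>F x in at_infinity. norm (star_Omega f x) \<le> \<delta> * norm (norm x)"
    using landau_o.smallD[OF growth \<delta>(1)] .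
  then obtain b where b: "\<And>x. norm x \<ge> b \<Longrightarrow> norm (star_Omega f x) \<le> \<delta> * norm x"
    unfolding eventually_at_infinity by auto
  have cW: "continuous_on UNIV Omega_sq"
  proof -
    have "(\<lambda>x. det (matrix (gram x))) differentiable (at x)" for x
      by (intro differentiable_det differentiable_gram_entry)
    then have "continuous_on UNIV (\<lambda>x. det (matrix (gram x)))"
      by (intro continuous_at_imp_continuous_on ballI differentiable_imp_continuous_within)
    then show ?thesis unfolding Omega_sq_def[abs_def] by (intro continuous_intros) (auto simp: det_gram_nonzero)
  qed
  have "compact (Omega_sq ` cball 0 \<bar>b\<bar>)"
    by (intro compact_continuous_image continuous_on_subset[OF cW]) auto
  from compact_imp_bounded[OF this] obtain M where M: "\<forall>y\<in>Omega_sq ` cball 0 \<bar>b\<bar>. norm y \<le> M"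
    unfolding bounded_iff by blast
  have "\<forall>\<^sub>F R in at_top. M \<le> \<epsilon> * R\<^sup>2"
  proof -
    have "filterlim (\<lambda>R. \<epsilon> * R\<^sup>2) at_top at_top"
      using assms by (intro filterlim_tendsto_pos_mult_at_top[OF tendsto_const] filterlim_pow_at_top filterlim_ident) auto
    then show ?thesis by (simp add: filterlim_at_top)
  qed
  then show ?thesis
    using eventually_ge_at_top[of "norm c"] eventually_ge_at_top[of 0]
  proof eventually_elim
    case (elim R)
    show ?case
    proof
      fix x assume x: "x \<in> cball c R"
      show "Omega_sq x \<le> \<epsilon> * R\<^sup>2"
      proof (cases "norm x \<le> \<bar>b\<bar>")
        case True
        then have "norm (Omega_sq x) \<le> M" using M by simp
        then show ?thesis using elim by simp
      next
        case False
        have "norm x \<le> 2 * R"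
          using x elim(2) norm_triangle_ineq4[of c "c - x"] by (simp add: dist_norm)
        moreover have "norm (star_Omega f x) \<le> \<delta> * norm x" using b False by simp
        ultimately have "norm (star_Omega f x) \<le> \<delta> * (2 * R)"
          using \<delta>(1) by (meson mult_left_mono less_imp_le order_trans)
        then have "(norm (star_Omega f x))\<^sup>2 \<le> (\<delta> * (2 * R))\<^sup>2" by (intro power_mono) auto
        then have "Omega_sq x \<le> (4 * \<delta>\<^sup>2) * R\<^sup>2" by (simp add: star_Omega_squared power_mult_distrib)
        then show ?thesis by (simp only: \<delta>(2))
      qed
    qed
  qed
qed

text \<open>
  The field \<open>Y \<tau>\<close> has constant divergence \<open>k\<close> and length at most \<open>sqrt k *\<Omega>\<close>, which is \<open>o(r)\<close>.
\<close>

lemma tau_eq_0: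
  assumes par: "parallel_mean_curvature (graph_param f)"
  shows "tau x = 0"
proof -
  obtain k where k: "\<And>x. sq_tau x = k" using sq_tau_constant[OF par] by blast
  have k0: "k \<ge> 0" using sq_tau_nonneg[of 0] k by simp
  have dV: "((\<lambda>x. Y x (tau x)) has_derivative (\<lambda>h. shape x h (tau x))) (at x)" for x
    using has_derivative_Y_tau[of x] by (simp add: parallel_tau[OF par] operator_linear)
  have "k \<le> 8 * 2 ^ DIM(real^'m) * \<epsilon>" if \<epsilon>: "\<epsilon> > 0" for \<epsilon>
  proof -
    \<comment> \<open>Dividing by \<open>k + 1\<close> rather than \<open>k\<close> allows for \<open>k = 0\<close>.\<close>
    have "\<forall>\<^sub>F R in at_top. \<forall>x\<in>cball 0 R. Omega_sq x \<le> (\<epsilon>\<^sup>2 / (k + 1)) * R\<^sup>2"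
      using \<epsilon> k0 by (intro Omega_sq_growth) simp
    then have "\<forall>\<^sub>F R in at_top. (\<forall>x\<in>cball 0 R. Omega_sq x \<le> (\<epsilon>\<^sup>2 / (k + 1)) * R\<^sup>2) \<and> R > 0"
      by (intro eventually_conj eventually_gt_at_top)
    then obtain R where R: "\<And>x. x \<in> cball 0 R \<Longrightarrow> Omega_sq x \<le> (\<epsilon>\<^sup>2 / (k + 1)) * R\<^sup>2" "R > 0"
      using eventually_happens[of _ at_top] by fastforce
    have "norm (Y x (tau x)) \<le> \<epsilon> * R" if "x \<in> cball 0 R" for x
    proof -
      have "(norm (Y x (tau x)))\<^sup>2 \<le> k * Omega_sq x" using norm_Y_tau_le[of x] k by simp
      also have "\<dots> \<le> k * ((\<epsilon>\<^sup>2 / (k + 1)) * R\<^sup>2)" using R(1)[OF that] k0 by (intro mult_left_mono)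
      also have "\<dots> = (k / (k + 1)) * (\<epsilon> * R)\<^sup>2" by (simp add: power_mult_distrib)
      also have "\<dots> \<le> 1 * (\<epsilon> * R)\<^sup>2" using k0 by (intro mult_right_mono) auto
      finally have "(norm (Y x (tau x)))\<^sup>2 \<le> (\<epsilon> * R)\<^sup>2" by simp
      then show ?thesis by (rule power2_le_imp_le) (use \<epsilon> R(2) in simp)
    qed
    moreover have "continuous_on UNIV (\<lambda>x. shape x i (tau x) \<bullet> i)" for i
      by (intro continuous_on_inner continuous_on_const continuous_shape_tau)
    moreover have "(\<Sum>i\<in>Basis. shape x i (tau x) \<bullet> i) = k" for x
      by (simp only: divergence_Y_tau k)
    ultimately show ?thesis
      using constant_divergence_le[OF dV _ _ R(2) _ k0] by blast
  qed
  then have le: "k \<le> 8 * 2 ^ DIM(real^'m) * \<epsilon>" if "\<epsilon> > 0" for \<epsilon> using that .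
  have "k \<le> 0"
  proof (rule ccontr)
    assume "\<not> k \<le> 0"
    then have "k > 0" by simp
    then have "k \<le> 8 * 2 ^ DIM(real^'m) * (k / (16 * 2 ^ DIM(real^'m)))" by (intro le) simp
    also have "\<dots> = k / 2" by simp
    finally show False using \<open>k > 0\<close> by simp
  qed
  then have "tau x \<bullet> tau x \<le> 0"
    using K_ge[of "tau x" x] k[of x] unfolding sq_tau_def K_symmetric by linarith
  then show ?thesis by (metis inner_gt_zero_iff not_le)
qed

text \<open>
  Let the radius tend to infinity in the interior estimate; the squared norm of the second
  fundamental form is then at most every positive number.
\<close>

lemma d2f_eq_0:
  assumes par: "parallel_mean_curvature (graph_param f)"
  shows "d2f c u v = 0"
proof -
  define C where "C = 14 * real CARD('n) * real CARD('m)"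
  have C: "C > 0" by (simp add: C_def)
  have "sq_sff c \<le> 0 + \<epsilon>" if \<epsilon>: "\<epsilon> > 0" for \<epsilon>
  proof -
    have "\<forall>\<^sub>F R in at_top. (\<forall>x\<in>cball c R. Omega_sq x \<le> (\<epsilon> / C) * R\<^sup>2) \<and> R > 0"
      using \<epsilon> C by (intro eventually_conj eventually_gt_at_top Omega_sq_growth) simp
    then obtain R where R: "\<And>x. x \<in> cball c R \<Longrightarrow> Omega_sq x \<le> (\<epsilon> / C) * R\<^sup>2" "R > 0"
      using eventually_happens[of _ at_top] by fastforce
    have "sq_sff c * R\<^sup>2 \<le> C * ((\<epsilon> / C) * R\<^sup>2)"
      unfolding C_def using interior_estimate_sq_sff[OF tau_eq_0[OF par] R(2) R(1)] by (simp add: C_def)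
    then show ?thesis using R(2) C by simp
  qed
  then have S0: "sq_sff c = 0" using field_le_epsilon[of "sq_sff c" 0] sq_sff_nonneg[of c] by (meson order_antisym)
  obtain e where e: "frame c e" using frame_exists by blast
  have nn: "d2f c (e p) (e q) \<bullet> K c (d2f c (e p) (e q)) \<ge> d2f c (e p) (e q) \<bullet> d2f c (e p) (e q)" for p q
    using K_ge[of "d2f c (e p) (e q)" c] unfolding K_symmetric .
  have nn0: "d2f c (e p) (e q) \<bullet> K c (d2f c (e p) (e q)) \<ge> 0" for p q
    using nn[of p q] inner_ge_zero order_trans by blast
  have "(\<Sum>p\<in>UNIV. \<Sum>q\<in>UNIV. d2f c (e p) (e q) \<bullet> K c (d2f c (e p) (e q))) = 0"
    using S0 unfolding sq_sff_def tensor_inner_frame[OF bilinear_d2f bilinear_d2f e] .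
  then have "d2f c (e p) (e q) \<bullet> K c (d2f c (e p) (e q)) = 0" for p q
    using nn0 by (simp add: sum_nonneg_eq_0_iff sum_nonneg)
  then have z: "d2f c (e p) (e q) = 0" for p q
    using nn[of p q] inner_ge_zero[of "d2f c (e p) (e q)"] by simp
  have ex: "w = (\<Sum>p\<in>UNIV. (gram c w \<bullet> e p) *\<^sub>R e p)" for w
    using e G_gram[of c w] unfolding frame_def by metis
  have "d2f c (e p) v = 0" for p
    by (subst ex[of v]) (simp add: linear_sum[OF linear_d2f2] linear_scale[OF linear_d2f2] z)
  then show ?thesis
    by (subst ex[of u]) (simp add: linear_sum[OF linear_d2f1] linear_scale[OF linear_d2f1])
qed

end

theorem theorem1:
  fixes f :: "real^'m \<Rightarrow> real^'n"
  assumes "smooth_map f"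
    and "spacelike (graph_param f)"
    and "parallel_mean_curvature (graph_param f)"
    and "star_Omega f \<in> o[at_infinity](\<lambda>x. norm x)"
  shows "spacelike_plane CARD('m) (range (graph_param f))"
proof -
  interpret controlled_spacelike_graph f
    by unfold_locales (fact assms)+
  have const: "df x u = df 0 u" for x u
  proof -
    have "((\<lambda>x. df x u) has_derivative (\<lambda>h. 0)) (at x)" for x
      using has_derivative_df[of u x] by (simp add: d2f_eq_0[OF assms(3)])
    then have "\<exists>a. \<forall>x\<in>UNIV. df x u = a"
      by (intro has_derivative_zero_constant) auto
    then show ?thesis by auto
  qed
  have aff: "f x = f 0 + df 0 x" for x
  proof -
    have "((\<lambda>x. f x - df 0 x) has_derivative (\<lambda>h. 0)) (at x)" for x
    proof -
      have "(f has_derivative df x) (at x)"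
        unfolding df_def by (intro dir_deriv_has_derivative smooth_map_differentiable smooth)
      moreover have "(df 0 has_derivative df 0) (at x)"
        by (intro linear_imp_has_derivative linear_df)
      ultimately have "((\<lambda>x. f x - df 0 x) has_derivative (\<lambda>h. df x h - df 0 h)) (at x)"
        by (rule has_derivative_diff)
      then show ?thesis by (simp add: const[of x])
    qed
    then have "\<exists>a. \<forall>x\<in>UNIV. f x - df 0 x = a"
      by (intro has_derivative_zero_constant) auto
    then have "f x - df 0 x = f 0 - df 0 0" by auto
    then show ?thesis by (simp add: linear_0[OF linear_df] algebra_simps)
  qed
  define L where "L u = (u, df 0 u)" for u
  have L: "linear L"
    by (auto intro!: linearI simp: L_def linear_add[OF linear_df] linear_scale[OF linear_df])
  have injL: "inj L" by (auto simp: L_def inj_on_def)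
  have graph: "graph_param f x = (0, f 0) + L x" for x
    by (simp add: graph_param_def L_def aff[of x])
  have range: "range (graph_param f) = (+) (0, f 0) ` range L"
    by (auto simp: graph image_image)
  have "subspace (range L)" using L by (simp add: linear_subspace_image)
  then have "affine (range (graph_param f))"
    unfolding range using affine_translation subspace_imp_affine by blast
  moreover have "aff_dim (range (graph_param f)) = int CARD('m)"
  proof -
    have "aff_dim (range (graph_param f)) = aff_dim (range L)"
      unfolding range by (rule aff_dim_translation_eq)
    also have "\<dots> = int (dim (range L))"
      using \<open>subspace (range L)\<close> by (simp add: aff_dim_subspace)
    also have "dim (range L) = CARD('m)"
      using dim_image_eq[OF L, of UNIV] injL by simp
    finally show ?thesis .
  qed
  moreover have "pinner (p - q) (p - q) > 0"
    if pq: "p \<in> range (graph_param f)" "q \<in> range (graph_param f)" "p \<noteq> q" for p q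
  proof -
    obtain x y where xy: "p = graph_param f x" "q = graph_param f y" using pq(1,2) by blast
    have "p - q = L (x - y)" unfolding xy graph by (simp add: linear_diff[OF L])
    moreover have "x - y \<noteq> 0" using pq(3) xy by auto
    then have "gram 0 (x - y) \<bullet> (x - y) > 0" by (rule gram_pos)
    ultimately show ?thesis by (simp add: L_def pinner_def gram_inner)
  qed
  ultimately show ?thesis by (auto simp: spacelike_plane_def)
qed

end
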